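(* Assume each $f_i$ is convex and $L$-smooth, and $g$ is $\mu$-strongly convex with $0<\mu\le L$. Run the algorithm ODAPG (described in the context) with constant parameters $\gamma_t=\gamma=\frac{1}{20\sqrt{L\mu}}$, $\tau_t=\tau=\mu\gamma$ and $K=\frac{15}{\sqrt{1-\lambda_2(W)}}$. Let $x^*$ denote the minimizer of $F$. Then $$\begin{aligned}\|\mathbf{z}_T-\mathbf{1}x^*\|^2\le{}&\left(1-\frac{1}{40}\sqrt{\frac{\mu}{L}}\right)^T\Bigg(\frac{2m}{\mu}\big(F(\overline{y}_1)-F(x^* )\big)+\|\mathbf{z}_1-\mathbf{1}x^*\|^2\\&+\frac{6\cdot 20^2L}{\mu}\Big(\|\Pi\mathbf{x}_1\|^2+c_1\|\Pi\mathbf{y}_1\|^2+c_2\|\Pi\mathbf{z}_1\|^2+c_3\gamma^2\|\Pi\mathbf{s}_1\|^2\Big)\Bigg),\end{aligned}$$ with $c_1=64$, $c_2=\frac{9\tau^2}{32}$ and $c_3=\frac{5\tau^2}{14}$.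
   Context: Problem: $f_1,\dots,f_m:\mathbb{R}^d\to\mathbb{R}$ and $g:\mathbb{R}^d\to\mathbb{R}$ (possibly non-differentiable); $f(x)=\frac1m\sum_{i=1}^m f_i(x)$, $F(x)=f(x)+g(x)$. Each agent $i\in\{1,\dots,m\}$ of a connected undirected static network holds $f_i$. "$f_i$ convex and $L$-smooth" means, for all $x,y\in\mathbb{R}^d$: $f_i(y)\ge f_i(x)+\langle\nabla f_i(x),y-x\rangle$ and $f_i(y)\le f_i(x)+\langle\nabla f_i(x),y-x\rangle+\frac L2\|x-y\|^2$. "$g$ is $\mu$-strongly convex" means $g(y)\ge g(x)+\langle\partial g(x),y-x\rangle+\frac\mu2\|y-x\|^2$ for all $x,y$ and any subgradient $\partial g(x)$ at $x$. Weight matrix: $W\in\mathbb{R}^{m\times m}$ is symmetric, $W_{i,j}\ne0$ iff agents $i,j$ are connected or $i=j$, $\mathbf{0}\preceq W\preceq I$, $W\mathbf{1}=\mathbf{1}$, $\mathrm{null}(I-W)=\mathrm{span}(\mathbf{1})$; $\lambda_2(W)$ is its second largest eigenvalue. Notation: vectors of $\mathbb{R}^d$ are identified with row vectors. Bold letters $\mathbf{x},\mathbf{y},\mathbf{z},\mathbf{s}$ denote $m\times d$ matrices with $i$-th row $\mathbf{x}^{(i)}$, etc.; $\overline{x}=\frac1m\mathbf{1}^\top\mathbf{x}$ is the average of the rows (similarly $\overline y,\overline z,\overline s$), $\mathbf{1}\in\mathbb{R}^m$ the all-ones vector, $\Pi=I_m-\frac{\mathbf{1}\mathbf{1}^\top}{m}$.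 $\|\cdot\|$ is the Frobenius (Euclidean) norm. $\nabla\widetilde f(\mathbf{x})$ is the $m\times d$ matrix with $i$-th row $\nabla f_i(\mathbf{x}^{(i)})$. $\mathrm{prox}_{\gamma g}(\mathbf{x})$ is the $m\times d$ matrix with $i$-th row $\mathrm{argmin}_{w\in\mathbb{R}^d}\{\gamma g(w)+\frac12\|w-\mathbf{x}^{(i)}\|^2\}$. $\mathrm{FastMix}(\mathbf{x},K)$: set $\mathbf{x}^0=\mathbf{x}^1=\mathbf{x}$, $\eta_w=1/(1+\sqrt{1-\lambda_2^2(W)})$, and for $k=1,\dots,K$ let $\mathbf{x}^{k+1}=(1+\eta_w)W\mathbf{x}^k-\eta_w\mathbf{x}^{k-1}$; the output is $\mathbf{x}^K$. ($K$ is an iteration count, understood as a positive integer.) Algorithm ODAPG: given $x_1\in\mathbb{R}^d$, set $\mathbf{z}_1=\mathbf{y}_1=\mathbf{x}_1=\mathbf{1}x_1$ and $\mathbf{s}_1=\nabla\widetilde f(\mathbf{x}_1)$. For $t=1,2,\dots$: $\mathbf{x}_{t+1}=\tau_t\mathbf{z}_t+(1-\tau_t)\mathbf{y}_t$; $\mathbf{s}_{t+1}=\mathrm{FastMix}(\mathbf{s}_t+\nabla\widetilde f(\mathbf{x}_{t+1})-\nabla\widetilde f(\mathbf{x}_t),K)$; $\mathbf{z}_{t+1}=\mathrm{FastMix}(\mathrm{prox}_{\gamma_t g}(\mathbf{z}_t-\gamma_t\mathbf{s}_{t+1}),K)$; $\mathbf{y}_{t+1}=\mathrm{FastMix}(\tau_t\mathbf{z}_{t+1}+(1-\tau_t)\mathbf{y}_t,K)$.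 *)

theory Defs
  imports "HOL-Analysis.Analysis"
begin

definition grad :: "('a::real_inner \<Rightarrow> real) \<Rightarrow> 'a \<Rightarrow> 'a" where
  "grad f x = (THE D. GDERIV f x :> D)"

definition convex_smooth :: "real \<Rightarrow> ('a::real_inner \<Rightarrow> real) \<Rightarrow> bool" where
  "convex_smooth L f \<longleftrightarrow>
     (\<forall>x. f differentiable (at x)) \<and>
     (\<forall>x y. f y \<ge> f x + grad f x \<bullet> (y - x)) \<and>
     (\<forall>x y. f y \<le> f x + grad f x \<bullet> (y - x) + L / 2 * (norm (x - y))\<^sup>2)"

definition is_subgradient :: "('a::real_inner \<Rightarrow> real) \<Rightarrow> 'a \<Rightarrow> 'a \<Rightarrow> bool" where
  "is_subgradient g x v \<longleftrightarrow> (\<forall>y. g y \<ge> g x + v \<bullet> (y - x))"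

text \<open>Convexity is required explicitly: the subgradient inequality alone would hold vacuously
  for a function without subgradients.\<close>

definition strongly_convex :: "real \<Rightarrow> ('a::real_inner \<Rightarrow> real) \<Rightarrow> bool" where
  "strongly_convex \<mu> g \<longleftrightarrow>
     convex_on UNIV g \<and>
     (\<forall>x y v. is_subgradient g x v \<longrightarrow> g y \<ge> g x + v \<bullet> (y - x) + \<mu> / 2 * (norm (y - x))\<^sup>2)"

definition prox :: "real \<Rightarrow> ('a::real_inner \<Rightarrow> real) \<Rightarrow> 'a \<Rightarrow> 'a" where
  "prox \<gamma> g v = (ARG_MIN (\<lambda>w. \<gamma> * g w + 1 / 2 * (norm (w - v))\<^sup>2) w. True)"

definition psd :: "real^'n^'n \<Rightarrow> bool" where
  "psd A \<longleftrightarrow> transpose A = A \<and> (\<forall>v. 0 \<le> v \<bullet> (A *v v))"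

definition null_space :: "real^'n^'m \<Rightarrow> (real^'n) set" where
  "null_space A = {v. A *v v = 0}"

definition eigenvalues :: "real^'n^'n \<Rightarrow> real set" where
  "eigenvalues A = {l. \<exists>v. v \<noteq> 0 \<and> A *v v = l *\<^sub>R v}"

text \<open>Second largest eigenvalue, counted with multiplicity, of a symmetric matrix: the largest
  eigenvalue \<open>l\<close> such that the eigenspaces of the eigenvalues \<open>\<ge> l\<close> have total dimension at
  least two.  It is unspecified for a 1-by-1 matrix.\<close>

definition lambda2 :: "real^'n^'n \<Rightarrow> real" where
  "lambda2 A =
     Max {l \<in> eigenvalues A.
            2 \<le> (\<Sum>k\<in>{k \<in> eigenvalues A. l \<le> k}. dim {v. A *v v = k *\<^sub>R v})}"

text \<open>A connected undirected network on the agents \<open>'m\<close> is given by its set \<open>E\<close> of (ordered)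
  edges.  The vector \<open>1 :: real^'m\<close> below is the all-ones vector.\<close>

definition connected_network :: "('m \<times> 'm) set \<Rightarrow> bool" where
  "connected_network E \<longleftrightarrow> sym E \<and> irrefl E \<and> E\<^sup>* = UNIV"

definition weight_matrix :: "('m \<times> 'm) set \<Rightarrow> real^'m^'m \<Rightarrow> bool" where
  "weight_matrix E W \<longleftrightarrow>
     transpose W = W \<and>
     (\<forall>i j. W $ i $ j \<noteq> 0 \<longleftrightarrow> (i, j) \<in> E \<or> i = j) \<and>
     psd W \<and> psd (mat 1 - W) \<and>
     W *v 1 = 1 \<and>
     null_space (mat 1 - W) = span {1}"

text \<open>An \<open>m \<times> d\<close> matrix is represented by its rows, with type \<open>real^'d^'m\<close>:
  \<open>norm\<close> on \<open>real^'d^'m\<close> is the Frobenius norm, and row \<open>i\<close> of \<open>X\<close> is \<open>X $ i\<close>.\<close>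

definition row_avg :: "real^'d^'m \<Rightarrow> real^'d" where
  "row_avg X = (1 / real CARD('m)) *\<^sub>R (\<Sum>i\<in>UNIV. X $ i)"

text \<open>\<open>rep_rows x\<close> is the matrix \<open>1 x\<close>, all of whose rows equal \<open>x\<close>.\<close>

definition rep_rows :: "real^'d \<Rightarrow> real^'d^'m" where
  "rep_rows x = (\<chi> i. x)"

definition Proj :: "real^'m^'m" where
  "Proj = mat 1 - (\<chi> i j. 1 / real CARD('m))"

definition grad_rows :: "('m \<Rightarrow> real^'d \<Rightarrow> real) \<Rightarrow> real^'d^'m \<Rightarrow> real^'d^'m" where
  "grad_rows f X = (\<chi> i. grad (f i) (X $ i))"

definition prox_rows :: "real \<Rightarrow> (real^'d \<Rightarrow> real) \<Rightarrow> real^'d^'m \<Rightarrow> real^'d^'m" where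
  "prox_rows \<gamma> g X = (\<chi> i. prox \<gamma> g (X $ i))"

definition avg_fun :: "('m::finite \<Rightarrow> real^'d \<Rightarrow> real) \<Rightarrow> real^'d \<Rightarrow> real" where
  "avg_fun f x = (1 / real CARD('m)) * (\<Sum>i\<in>UNIV. f i x)"

definition objective :: "('m::finite \<Rightarrow> real^'d \<Rightarrow> real) \<Rightarrow> (real^'d \<Rightarrow> real) \<Rightarrow> real^'d \<Rightarrow> real" where
  "objective f g x = avg_fun f x + g x"

fun fastmix_iter :: "real^'m^'m \<Rightarrow> real \<Rightarrow> real^'d^'m \<Rightarrow> nat \<Rightarrow> real^'d^'m" where
  "fastmix_iter W \<eta> X 0 = X"
| "fastmix_iter W \<eta> X (Suc 0) = X"
| "fastmix_iter W \<eta> X (Suc (Suc k)) =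
     (1 + \<eta>) *\<^sub>R (W ** fastmix_iter W \<eta> X (Suc k)) - \<eta> *\<^sub>R fastmix_iter W \<eta> X k"

definition FastMix :: "real^'m^'m \<Rightarrow> real^'d^'m \<Rightarrow> nat \<Rightarrow> real^'d^'m" where
  "FastMix W X K = fastmix_iter W (1 / (1 + sqrt (1 - (lambda2 W)\<^sup>2))) X K"

text \<open>The sequences are indexed from 1; their values at index 0 are irrelevant.\<close>

definition ODAPG ::
  "real^'m^'m \<Rightarrow> ('m \<Rightarrow> real^'d \<Rightarrow> real) \<Rightarrow> (real^'d \<Rightarrow> real) \<Rightarrow> (nat \<Rightarrow> real) \<Rightarrow> (nat \<Rightarrow> real) \<Rightarrow> nat \<Rightarrow>
   real^'d \<Rightarrow> (nat \<Rightarrow> real^'d^'m) \<Rightarrow> (nat \<Rightarrow> real^'d^'m) \<Rightarrow> (nat \<Rightarrow> real^'d^'m) \<Rightarrow> (nat \<Rightarrow> real^'d^'m) \<Rightarrow>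
   bool" where
  "ODAPG W f g \<gamma> \<tau> K x\<^sub>1 x y z s \<longleftrightarrow>
     x 1 = rep_rows x\<^sub>1 \<and> y 1 = rep_rows x\<^sub>1 \<and> z 1 = rep_rows x\<^sub>1 \<and>
     s 1 = grad_rows f (x 1) \<and>
     (\<forall>t\<ge>1.
        x (t + 1) = \<tau> t *\<^sub>R z t + (1 - \<tau> t) *\<^sub>R y t \<and>
        s (t + 1) = FastMix W (s t + grad_rows f (x (t + 1)) - grad_rows f (x t)) K \<and>
        z (t + 1) = FastMix W (prox_rows (\<gamma> t) g (z t - \<gamma> t *\<^sub>R s (t + 1))) K \<and>
        y (t + 1) = FastMix W (\<tau> t *\<^sub>R z (t + 1) + (1 - \<tau> t) *\<^sub>R y t) K)"

end

theory Submission
  imports Defs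
begin

text \<open>
  The proof treats the algorithm as Nesterov's accelerated proximal gradient method for the row
  averages, perturbed by the disagreement of the agents, and exhibits one Lyapunov function for both.

  With exact gradients and no disagreement, the usual estimate for one step is
  \<open>V' + (1 + \<tau>) / 2 * D' \<le> (1 - \<tau>) * V + 1 / 2 * D - gain\<close>,
  where \<open>V\<close> is \<open>m / \<mu>\<close> times the gap of the objective at the average of \<open>y\<close>, and \<open>D\<close> is the squared
  distance of \<open>z\<close> to the minimizer.  Two gains matter: a multiple of the squared length of the
  proximal step, and the Bregman gap between the average of \<open>y\<close> and the points \<open>x\<close> at which the gradients
  are taken (\<open>convex_smooth_bregman_lower\<close>).  Disagreement adds errors that are quadratic in the
  distances of \<open>x\<close>, \<open>z\<close> and \<open>s\<close> to their row averages (\<open>odapg_step_inequality\<close>).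

  FastMix preserves row averages.  On the complement of the all-ones vector it acts on each
  eigenvector of \<open>W\<close> by a polynomial with momentum, and the chosen number of iterations makes its
  square at most \<open>1 / 8192\<close>, independently of the spectral gap (\<open>norm_Proj_FastMix_le\<close>).  Hence each
  disagreement is a small multiple of the previous ones, except that the gradient trackers \<open>s\<close> also
  receive the change of the gradients.  That change is bounded by exactly the two gains above: its
  part between the average of \<open>y\<close> and the next \<open>x\<close> by the Bregman gap, and its part between the present
  \<open>x\<close> and the average of \<open>y\<close> by the preceding proximal step.  After dividing the disagreement of \<open>y\<close> by
  \<open>\<tau>\<close> and multiplying that of \<open>s\<close> by \<open>\<gamma>\<close>, no coefficient depends on the condition number
  any more, and the sum of squares \<open>\<Psi>\<close> can be added to the estimate
  (\<open>odapg_lyapunov_step\<close>).  The resulting inequality contracts by \<open>1 - \<tau> / 2\<close>, and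
  \<open>geometric_decay\<close> turns it into the claimed rate.
\<close>

section \<open>Spectral decomposition of the weight matrix\<close>

lemma sym_matrix_inner:
  fixes W :: "real^'n^'n"
  assumes "transpose W = W"
  shows "u \<bullet> (W *v v) = (W *v u) \<bullet> v"
  using assms by (metis dot_lmul_matrix transpose_matrix_vector)

lemma linear_coeff_zero_of_nonneg:
  fixes a b :: real
  assumes "\<And>t. 0 \<le> t * a + t\<^sup>2 * b"
  shows "a = 0"
proof (rule ccontr)
  assume a: "a \<noteq> 0"
  define c where "c = \<bar>b\<bar> + 1"
  define t where "t = - a / (2 * c)"
  have c: "0 < c" "b \<le> c" by (auto simp: c_def)
  have "t * a + t\<^sup>2 * b \<le> t * a + t\<^sup>2 * c"
    using c by (intro add_left_mono mult_left_mono) auto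
  also have "\<dots> = - (a\<^sup>2 / (4 * c))"
    using c by (simp add: t_def field_simps power2_eq_square)
  also have "\<dots> < 0"
    using a c by simp
  finally show False using assms[of t] by simp
qed

text \<open>The maximum of the quadratic form on the unit sphere of the invariant subspace is attained; at a
  maximizer \<open>u\<close> with value \<open>l\<close>, the form \<open>l * (v \<bullet> v) - v \<bullet> (W *v v)\<close> is nonnegative on the
  subspace and vanishes at \<open>u\<close>, so its first variation there in the direction of the residual
  \<open>l *\<^sub>R u - W *v u\<close> is zero, which makes the residual vanish.\<close>

lemma sym_matrix_eigenvector:
  fixes W :: "real^'n^'n"
  assumes sym: "transpose W = W" and S: "subspace S" and ne: "S \<noteq> {0}"
    and inv: "\<And>v. v \<in> S \<Longrightarrow> W *v v \<in> S"
  obtains u l where "u \<in> S" "norm u = 1" "W *v u = l *\<^sub>R u"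
proof -
  let ?Q = "\<lambda>v. v \<bullet> (W *v v)"
  obtain w where w: "w \<in> S" "w \<noteq> 0"
    using ne S subspace_0 by blast
  have "compact (S \<inter> sphere 0 1)"
    by (simp add: S closed_Int_compact closed_subspace)
  moreover have "(1 / norm w) *\<^sub>R w \<in> S \<inter> sphere 0 1"
    using w S by (simp add: subspace_scale)
  moreover have "continuous_on (S \<inter> sphere 0 1) ?Q"
    by (intro continuous_intros matrix_vector_mult_linear_continuous_on)
  ultimately obtain u where u: "u \<in> S \<inter> sphere 0 1"
      and max: "\<And>v. v \<in> S \<inter> sphere 0 1 \<Longrightarrow> ?Q v \<le> ?Q u"
    by (metis (no_types, lifting) continuous_attains_sup empty_iff)
  define l where "l = ?Q u"
  have uS: "u \<in> S" and un: "norm u = 1" using u by auto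
  have uu: "u \<bullet> u = 1" using un by (simp add: norm_eq_1)
  have bound: "?Q v \<le> l * (v \<bullet> v)" if v: "v \<in> S" for v
  proof (cases "v = 0")
    case False
    let ?v = "(1 / norm v) *\<^sub>R v"
    have "?v \<in> S \<inter> sphere 0 1" using v False S by (simp add: subspace_scale)
    from max[OF this] have "?Q v / (norm v)\<^sup>2 \<le> l"
      by (simp add: l_def scaleR_matrix_vector_assoc[symmetric] matrix_vector_mult_scaleR
          power2_eq_square divide_simps)
    then show ?thesis using False by (simp add: pos_divide_le_eq power2_norm_eq_inner)
  qed simp
  let ?r = "l *\<^sub>R u - W *v u"
  have rS: "?r \<in> S" using uS inv S by (simp add: subspace_diff subspace_scale)
  have "0 \<le> t * (2 * (?r \<bullet> ?r)) + t\<^sup>2 * (l * (?r \<bullet> ?r) - ?Q ?r)" for t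
  proof -
    have "u + t *\<^sub>R ?r \<in> S" using uS rS S by (simp add: subspace_add subspace_scale)
    from bound[OF this]
    have "0 \<le> l * ((u + t *\<^sub>R ?r) \<bullet> (u + t *\<^sub>R ?r)) - ?Q (u + t *\<^sub>R ?r)" by simp
    also have "\<dots> = l * (u \<bullet> u) - ?Q u + t * (2 * ((l *\<^sub>R u - W *v u) \<bullet> ?r))
        + t\<^sup>2 * (l * (?r \<bullet> ?r) - ?Q ?r)"
    proof -
      obtain r where r: "r = ?r" by simp
      have "u \<bullet> (W *v r) = (W *v u) \<bullet> r" "r \<bullet> (W *v u) = (W *v u) \<bullet> r" "r \<bullet> u = u \<bullet> r"
        using sym_matrix_inner[OF sym] by (simp_all add: inner_commute)
      moreover have "r \<bullet> r = l * (u \<bullet> r) - (W *v u) \<bullet> r"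
        by (subst r) (simp add: inner_diff_left)
      then have "t * (l * (u \<bullet> r)) = t * (r \<bullet> r + (W *v u) \<bullet> r)" by simp
      then have "l * (t * (u \<bullet> r)) = t * (r \<bullet> r) + t * ((W *v u) \<bullet> r)"
        by (simp add: algebra_simps)
      ultimately show ?thesis unfolding r[symmetric]
        by (simp add: matrix_vector_right_distrib matrix_vector_mult_scaleR inner_add_left
            inner_add_right inner_diff_left inner_diff_right algebra_simps power2_eq_square)
    qed
    finally show ?thesis by (simp add: uu l_def)
  qed
  then have "2 * (?r \<bullet> ?r) = 0" by (rule linear_coeff_zero_of_nonneg)
  then have "W *v u = l *\<^sub>R u" by simp
  with that uS un show thesis by blast
qed

text \<open>The spectral theorem on an invariant subspace: split off one eigenvector, and recurse on
  its orthogonal complement within the subspace, which is again invariant by symmetry.\<close>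

lemma sym_matrix_eigenbasis:
  fixes W :: "real^'n^'n"
  assumes sym: "transpose W = W" and "subspace S"
    and "\<And>v. v \<in> S \<Longrightarrow> W *v v \<in> S"
  shows "\<exists>B. finite B \<and> pairwise orthogonal B \<and> B \<subseteq> S \<and> span B = S \<and>
    (\<forall>b\<in>B. norm b = 1 \<and> (\<exists>l. W *v b = l *\<^sub>R b))"
  using assms(2,3)
proof (induction "dim S" arbitrary: S rule: less_induct)
  case less
  show ?case
  proof (cases "S = {0}")
    case True
    then show ?thesis by (intro exI[of _ "{}"]) (auto simp: pairwise_def)
  next
    case False
    obtain u l where u: "u \<in> S" "norm u = 1" "W *v u = l *\<^sub>R u"
      using sym_matrix_eigenvector[OF sym less.prems(1) False less.prems(2)] by blast
    define S' where "S' = {v \<in> S. orthogonal u v}"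
    have S': "subspace S'"
      using less.prems(1) by (auto simp: S'_def subspace_def orthogonal_clauses)
    have inv': "W *v v \<in> S'" if "v \<in> S'" for v
      using that less.prems(2) sym_matrix_inner[OF sym, of u v] u(3)
      by (auto simp: S'_def orthogonal_def)
    have "u \<notin> S'" using u(2) by (auto simp: S'_def orthogonal_self)
    moreover have "S' \<subseteq> S" by (auto simp: S'_def)
    ultimately have "dim S' < dim S"
      using u(1) S' less.prems(1)
      by (metis dim_psubset psubsetI span_eq_iff)
    from less.hyps[OF this S' inv'] obtain B where B: "finite B" "pairwise orthogonal B"
      "B \<subseteq> S'" "span B = S'" "\<forall>b\<in>B. norm b = 1 \<and> (\<exists>l. W *v b = l *\<^sub>R b)" by blast
    have "S \<subseteq> span (insert u B)"
    proof
      fix v assume v: "v \<in> S"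
      have "v - (u \<bullet> v) *\<^sub>R u \<in> S'"
        using v u less.prems(1)
        by (auto simp: S'_def orthogonal_def inner_diff_right subspace_diff subspace_scale norm_eq_1)
      then show "v \<in> span (insert u B)"
        using B(4) by (auto simp: span_insert)
    qed
    moreover have "span (insert u B) \<subseteq> S"
      by (rule span_minimal) (use u B(3) \<open>S' \<subseteq> S\<close> less.prems(1) in auto)
    moreover have "pairwise orthogonal (insert u B)"
      using B(2,3) by (auto simp: pairwise_insert S'_def orthogonal_commute)
    ultimately show ?thesis
      using B u \<open>S' \<subseteq> S\<close> by (intro exI[of _ "insert u B"]) auto
  qed
qed

lemma norm_sq_eq_sum_orthonormal_coeffs:
  fixes v :: "'a::euclidean_space"
  assumes "finite B" "pairwise orthogonal B" "\<And>b. b \<in> B \<Longrightarrow> norm b = 1" "v \<in> span B"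
  shows "(norm v)\<^sup>2 = (\<Sum>b\<in>B. (b \<bullet> v)\<^sup>2)"
proof -
  have "(\<Sum>b\<in>B. (v \<bullet> b) *\<^sub>R b) = v"
    by (rule orthonormal_basis_expand) (use assms in auto)
  then have "(norm v)\<^sup>2 = (norm (\<Sum>b\<in>B. (v \<bullet> b) *\<^sub>R b))\<^sup>2" by simp
  also have "\<dots> = (\<Sum>b\<in>B. (norm ((v \<bullet> b) *\<^sub>R b))\<^sup>2)"
    using assms by (intro norm_sum_Pythagorean pairwise_ortho_scaleR) auto
  also have "\<dots> = (\<Sum>b\<in>B. (b \<bullet> v)\<^sup>2)"
    using assms by (intro sum.cong) (auto simp: inner_commute)
  finally show ?thesis .
qed

lemma finite_eigenvalues_sym:
  fixes W :: "real^'n^'n"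
  assumes sym: "transpose W = W"
  shows "finite (eigenvalues W)"
proof -
  define e where "e l = (SOME v. v \<noteq> 0 \<and> W *v v = l *\<^sub>R v)" for l
  have e: "e l \<noteq> 0 \<and> W *v e l = l *\<^sub>R e l" if "l \<in> eigenvalues W" for l
    using that someI_ex[of "\<lambda>v. v \<noteq> 0 \<and> W *v v = l *\<^sub>R v"]
    by (auto simp: eigenvalues_def e_def)
  have orth: "orthogonal (e k) (e l)" if "k \<in> eigenvalues W" "l \<in> eigenvalues W" "k \<noteq> l" for k l
    using sym_matrix_inner[OF sym, of "e k" "e l"] e that by (auto simp: orthogonal_def)
  have "inj_on e (eigenvalues W)"
    by (rule inj_onI) (metis e orth orthogonal_self)
  moreover have "finite (e ` eigenvalues W)"
    using orth by (intro pairwise_orthogonal_imp_finite) (auto simp: pairwise_def)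
  ultimately show ?thesis by (simp add: finite_image_iff)
qed

lemma dim_ge_1:
  assumes "v \<in> V" "v \<noteq> (0::'a::euclidean_space)"
  shows "1 \<le> dim V"
proof -
  have "dim {v} \<le> dim V" using assms(1) by (intro dim_subset) simp
  then show ?thesis using assms(2) by simp
qed

text \<open>The all-ones vector accounts for one dimension at eigenvalue 1, so any eigenvector orthogonal to
  it supplies a second dimension at or above its own eigenvalue; hence that eigenvalue competes in
  the maximum defining \<^const>\<open>lambda2\<close>.  Conversely, the eigenspace of 1 is one-dimensional, which
  excludes 1 from that maximum.\<close>

lemma eigenvalue_orthogonal_to_ones:
  fixes W :: "real^'m^'m"
  assumes W: "weight_matrix E W" and b: "b \<noteq> 0" "b \<bullet> 1 = 0" "W *v b = l *\<^sub>R b"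
  shows "0 \<le> l" "l \<le> lambda2 W" "lambda2 W < 1"
proof -
  have sym: "transpose W = W" and p1: "psd W" and p2: "psd (mat 1 - W)" and W1: "W *v 1 = 1"
    and null: "null_space (mat 1 - W) = span {1}"
    using W by (auto simp: weight_matrix_def)
  let ?ev = "eigenvalues W"
  let ?m = "\<lambda>k. dim {v. W *v v = k *\<^sub>R v}"
  let ?C = "{l \<in> ?ev. 2 \<le> (\<Sum>k\<in>{k \<in> ?ev. l \<le> k}. ?m k)}"
  have fin: "finite ?ev" by (rule finite_eigenvalues_sym[OF sym])
  have ev: "0 \<le> k \<and> k \<le> 1" if "k \<in> ?ev" for k
  proof -
    obtain v where v: "v \<noteq> 0" "W *v v = k *\<^sub>R v" using \<open>k \<in> ?ev\<close> by (auto simp: eigenvalues_def)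
    have "0 \<le> k * (v \<bullet> v)" using p1 v by (metis inner_scaleR_right psd_def)
    moreover have "0 \<le> v \<bullet> ((mat 1 - W) *v v)" using p2 by (auto simp: psd_def)
    then have "0 \<le> (1 - k) * (v \<bullet> v)"
      using v by (simp add: matrix_vector_mult_diff_rdistrib inner_diff_right algebra_simps)
    ultimately show ?thesis using v(1)
      by (metis diff_ge_0_iff_ge inner_gt_zero_iff linorder_not_le mult_le_0_iff zero_le_mult_iff)
  qed
  have one: "(1::real^'m) \<noteq> 0" by (simp add: vec_eq_iff)
  have one_ev: "1 \<in> ?ev" using W1 one by (auto simp: eigenvalues_def intro!: exI[of _ 1])
  have "(W *v v = 1 *\<^sub>R v) = ((mat 1 - W) *v v = 0)" for v
    unfolding matrix_vector_mult_diff_rdistrib by (metis eq_iff_diff_eq_0 matrix_vector_mul_lid scaleR_one)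
  then have fix1: "{v. W *v v = 1 *\<^sub>R v} = span {1}"
    unfolding null[symmetric] null_space_def by simp
  have l_ev: "l \<in> ?ev" using b by (auto simp: eigenvalues_def)
  then show "0 \<le> l" using ev by blast
  have "l \<noteq> 1"
  proof
    assume "l = 1"
    then have "b \<in> span {1}" using b(3) fix1 by auto
    then obtain c where "b = c *\<^sub>R 1" by (auto simp: span_singleton)
    then have "c * real CARD('m) = 0" using b(2) by (simp add: inner_vec_def)
    then show False using \<open>b = c *\<^sub>R 1\<close> b(1) by simp
  qed
  have "2 \<le> ?m l + ?m 1"
    using dim_ge_1[of b "{v. W *v v = l *\<^sub>R v}"] dim_ge_1[of 1 "{v. W *v v = 1 *\<^sub>R v}"] b W1 one
    by simp
  also have "\<dots> = (\<Sum>k\<in>{l, 1}. ?m k)" using \<open>l \<noteq> 1\<close> by simp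
  also have "\<dots> \<le> (\<Sum>k\<in>{k \<in> ?ev. l \<le> k}. ?m k)"
    using fin l_ev one_ev ev by (intro sum_mono2) auto
  finally have lC: "l \<in> ?C" using l_ev by simp
  have finC: "finite ?C" using fin by simp
  show "l \<le> lambda2 W" unfolding lambda2_def using finC lC by (rule Max_ge)
  have "k < 1" if "k \<in> ?C" for k
  proof -
    have "k \<noteq> 1"
    proof
      assume "k = 1"
      have "{k \<in> ?ev. 1 \<le> k} = {1}" using ev one_ev by force
      then have "2 \<le> ?m 1" using that \<open>k = 1\<close> by simp
      moreover have "?m 1 = 1" unfolding fix1 dim_span using one by simp
      ultimately show False by simp
    qed
    then show ?thesis using ev that by fastforce
  qed
  then show "lambda2 W < 1" unfolding lambda2_def using finC lC by (subst Max_less_iff) auto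
qed

section \<open>The momentum polynomials of FastMix\<close>

text \<open>FastMix acts on an eigenvector of \<open>W\<close> with eigenvalue \<open>l\<close> as multiplication by these
  polynomials in \<open>l\<close>.\<close>

fun momentum_poly :: "real \<Rightarrow> real \<Rightarrow> nat \<Rightarrow> real" where
  "momentum_poly \<eta> l 0 = 1"
| "momentum_poly \<eta> l (Suc 0) = 1"
| "momentum_poly \<eta> l (Suc (Suc k)) = (1 + \<eta>) * l * momentum_poly \<eta> l (Suc k) - \<eta> * momentum_poly \<eta> l k"

text \<open>The left-hand side is \<open>\<bar>q - r * p\<bar>\<^sup>2\<close> for consecutive values \<open>p\<close>, \<open>q\<close> and a characteristic root
  \<open>r\<close> when the two roots are complex conjugates; each step multiplies it by \<open>\<eta>\<close>, the product of
  the roots.\<close>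

lemma momentum_poly_invariant:
  "(momentum_poly \<eta> l (Suc k))\<^sup>2 - (1 + \<eta>) * l * momentum_poly \<eta> l k * momentum_poly \<eta> l (Suc k)
     + \<eta> * (momentum_poly \<eta> l k)\<^sup>2 = \<eta> ^ k * ((1 + \<eta>) * (1 - l))"
proof (induction k)
  case (Suc k)
  let ?p = "momentum_poly \<eta> l k" and ?q = "momentum_poly \<eta> l (Suc k)"
  have "((1 + \<eta>) * l * ?q - \<eta> * ?p)\<^sup>2 - (1 + \<eta>) * l * ?q * ((1 + \<eta>) * l * ?q - \<eta> * ?p)
      + \<eta> * ?q\<^sup>2 = \<eta> * (?q\<^sup>2 - (1 + \<eta>) * l * ?p * ?q + \<eta> * ?p\<^sup>2)"
    by (simp add: algebra_simps power2_eq_square)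
  then show ?case using Suc by simp
qed (simp add: algebra_simps)

text \<open>The momentum parameter makes the characteristic roots complex with modulus \<open>sqrt \<eta>\<close> for all
  \<open>0 \<le> l \<le> L2\<close>, so the invariant is a positive definite form in two consecutive values.  The
  form degenerates as \<open>l\<close> and \<open>L2\<close> tend to 1, but so does its initial value \<open>(1 + \<eta>) * (1 - l)\<close>, and
  the resulting quotient stays at most \<open>4 / 3 * (1 + \<eta>)\<close>.\<close>

lemma momentum_poly_sq_le:
  fixes l L2 :: real
  defines "u \<equiv> sqrt (1 - L2\<^sup>2)"
  defines "\<eta> \<equiv> 1 / (1 + u)"
  assumes l: "0 \<le> l" "l \<le> L2" "L2 < 1"
  shows "(momentum_poly \<eta> l (Suc k))\<^sup>2 \<le> 4 / 3 * (1 + \<eta>) * \<eta> ^ k"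
proof -
  have L20: "0 \<le> L2" using l by linarith
  have "L2\<^sup>2 < 1" using l L20 by (simp add: abs_square_less_1)
  then have u0: "0 < u" and u2: "u\<^sup>2 = 1 - L2\<^sup>2" unfolding u_def by simp_all
  have u1: "u \<le> 1" unfolding u_def by simp
  have \<eta>0: "0 < \<eta>" using u0 by (simp add: \<eta>_def)
  define b where "b = (1 + \<eta>)\<^sup>2 / (4 * \<eta>)"
  have b_eq: "b = (2 + u)\<^sup>2 / (4 * (1 + u))"
  proof -
    have "(1 + 1 / w)\<^sup>2 / (4 * (1 / w)) = (1 + w)\<^sup>2 / (4 * w)" if "0 < w" for w :: real
      using that by (simp add: field_simps power2_eq_square)
    moreover have "0 < 1 + u" using u0 by simp
    ultimately have "(1 + 1 / (1 + u))\<^sup>2 / (4 * (1 / (1 + u))) = (1 + (1 + u))\<^sup>2 / (4 * (1 + u))"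
      by blast
    then show ?thesis unfolding b_def \<eta>_def by (simp only: add.assoc[symmetric] one_add_one)
  qed
  have b0: "0 < b" using u0 by (simp add: b_eq)
  \<comment> \<open>The difference of the two sides of \<open>1 - l \<le> 4 / 3 * (1 - b * l\<^sup>2)\<close> is concave in \<open>l\<close> and
     nonnegative at \<open>0\<close>; so the inequality is only needed at the other end \<open>l = L2\<close>.\<close>
  have end2: "1 - L2 \<le> 4 / 3 * (1 - b * L2\<^sup>2)"
  proof -
    have L22: "L2\<^sup>2 = (1 - u) * (1 + u)" using u2 by (simp add: algebra_simps power2_eq_square)
    have "1 - b * L2\<^sup>2 = 1 - (2 + u)\<^sup>2 * (1 - u) / 4"
      unfolding b_eq L22 using u0 by (simp add: field_simps)
    also have "\<dots> = (3 * u\<^sup>2 + u ^ 3) / 4" by (simp add: field_simps power2_eq_square power3_eq_cube)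
    also have "\<dots> \<ge> 3 / 4 * u\<^sup>2" using u0 by simp
    finally have "u\<^sup>2 \<le> 4 / 3 * (1 - b * L2\<^sup>2)" by simp
    moreover have "1 - L2 \<le> u\<^sup>2" unfolding u2 using l L20 by (simp add: power2_eq_square mult_left_le)
    ultimately show ?thesis by linarith
  qed
  have quot: "1 - l \<le> 4 / 3 * (1 - b * l\<^sup>2)"
  proof -
    have "b * l\<^sup>2 \<le> b * (l * L2)" using l b0 by (simp add: power2_eq_square mult_left_mono)
    moreover have "4 * b * L2 * l \<le> (1 + 3 * L2) / L2 * l" if "L2 \<noteq> 0"
    proof -
      have "4 * b * L2\<^sup>2 \<le> 1 + 3 * L2" using end2 by simp
      then have "4 * b * L2 \<le> (1 + 3 * L2) / L2"
        using that L20 by (simp add: field_simps power2_eq_square)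
      from mult_right_mono[OF this l(1)] show ?thesis .
    qed
    moreover have "(1 + 3 * L2) / L2 * l \<le> 1 + 3 * l" if "L2 \<noteq> 0"
      using that L20 l by (simp add: field_simps)
    ultimately show ?thesis using l by (cases "L2 = 0") (auto simp: algebra_simps)
  qed
  let ?p = "momentum_poly \<eta> l k" and ?q = "momentum_poly \<eta> l (Suc k)"
  show ?thesis
  proof (cases "l = 1")
    case False
    \<comment> \<open>complete the square in \<open>?p\<close>\<close>
    have sq: "?q\<^sup>2 - (1 + \<eta>) * l * ?p * ?q + \<eta> * ?p\<^sup>2
        = \<eta> * (?p - (1 + \<eta>) * l * ?q / (2 * \<eta>))\<^sup>2 + (1 - b * l\<^sup>2) * ?q\<^sup>2"
      using \<eta>0 by (simp add: b_def field_simps power2_eq_square)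
    have "3 / 4 * (1 - l) * ?q\<^sup>2 \<le> (1 - b * l\<^sup>2) * ?q\<^sup>2"
      using quot by (intro mult_right_mono) auto
    also have "\<dots> \<le> \<eta> ^ k * ((1 + \<eta>) * (1 - l))"
      using momentum_poly_invariant[of \<eta> l k] \<eta>0 unfolding sq
      by (smt (verit) mult_nonneg_nonneg zero_le_power2)
    finally have "(1 - l) * (3 / 4 * ?q\<^sup>2) \<le> (1 - l) * (\<eta> ^ k * (1 + \<eta>))" by (simp add: algebra_simps)
    moreover have "0 < 1 - l" using False l by simp
    ultimately have "3 / 4 * ?q\<^sup>2 \<le> \<eta> ^ k * (1 + \<eta>)" by (metis mult_le_cancel_left_pos)
    then have "?q\<^sup>2 \<le> 4 / 3 * ((1 + \<eta>) * \<eta> ^ k)" by (simp add: mult.commute)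
    then show ?thesis by (simp only: mult.assoc)
  qed (use l in auto)
qed

lemma two_powr_le_1_plus:
  fixes v :: real
  assumes "0 \<le> v" "v \<le> 1"
  shows "2 powr v \<le> 1 + v"
proof -
  have "exp ((1 - v) *\<^sub>R 0 + v *\<^sub>R ln 2) \<le> (1 - v) * exp 0 + v * exp (ln 2 :: real)"
    by (rule convex_onD[OF exp_convex]) (use assms in auto)
  then show ?thesis by (simp add: powr_def algebra_simps)
qed

text \<open>With \<open>v = sqrt (1 - L2)\<close>, the decay factor \<open>\<eta>\<close> of the squares is at most \<open>1 / (1 + v) \<le> 2 powr - v\<close>, so
  \<open>15 / v\<close> steps gain a factor \<open>2 ^ 15\<close>, of which the constant in the previous bound costs \<open>2 ^ 2\<close>.\<close>

lemma momentum_poly_small: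
  fixes l L2 :: real
  assumes l: "0 \<le> l" "l \<le> L2" "L2 < 1" and K: "K = nat \<lceil>15 / sqrt (1 - L2)\<rceil>"
  shows "(momentum_poly (1 / (1 + sqrt (1 - L2\<^sup>2))) l K)\<^sup>2 \<le> 1 / 8192"
proof -
  define u where "u = sqrt (1 - L2\<^sup>2)"
  define \<eta> where "\<eta> = 1 / (1 + u)"
  define v where "v = sqrt (1 - L2)"
  have L20: "0 \<le> L2" using l by linarith
  have v0: "0 < v" and v1: "v \<le> 1" using l L20 by (auto simp: v_def)
  have uv: "v \<le> u" using l L20 by (simp add: u_def v_def power2_eq_square mult_left_le)
  have u1: "u \<le> 1" unfolding u_def by simp
  have "0 < 15 / v" using v0 by simp
  then obtain k where k: "K = Suc k" using K v_def
    by (metis gr0_implies_Suc zero_less_ceiling zero_less_nat_eq)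
  have Kv: "15 \<le> v * real K"
  proof -
    have "15 / v \<le> real K" unfolding K v_def by (rule real_nat_ceiling_ge)
    then show ?thesis using v0 by (simp add: field_simps)
  qed
  have "2 ^ 15 = 2 powr (15::real)" by (simp add: powr_realpow[symmetric])
  also have "\<dots> \<le> 2 powr (v * real K)" using Kv by (intro powr_mono) auto
  also have "\<dots> = (2 powr v) ^ K" by (simp add: powr_powr[symmetric] powr_realpow)
  also have "\<dots> \<le> (1 + u) ^ K"
    using two_powr_le_1_plus[of v] v0 v1 uv by (intro power_mono) auto
  finally have big: "2 ^ 15 \<le> (1 + u) ^ K" .
  have "(momentum_poly \<eta> l (Suc k))\<^sup>2 \<le> 4 / 3 * (1 + \<eta>) * \<eta> ^ k"
    unfolding \<eta>_def u_def by (rule momentum_poly_sq_le) (use l in auto)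
  also have "\<dots> = 4 / 3 * (2 + u) / (1 + u) ^ K"
    using v0 uv by (simp add: \<eta>_def k power_divide field_simps)
  also have "\<dots> \<le> 4 / 2 ^ 15"
    using big u1 v0 uv by (intro frac_le) auto
  finally show ?thesis by (simp add: \<eta>_def u_def k)
qed

section \<open>Row averages and disagreement\<close>

lemma Proj_mult_eq: "Proj ** X = X - rep_rows (row_avg X)"
  for X :: "real^'d^'m"
  by (simp add: vec_eq_iff Proj_def rep_rows_def row_avg_def matrix_matrix_mult_def mat_def
      left_diff_distrib sum_subtractf if_distrib[of "\<lambda>c. c * _"] sum_divide_distrib
      cong: if_cong)

lemma sum_rows: "(\<Sum>i\<in>UNIV. X $ i) = real CARD('m) *\<^sub>R row_avg X"
  for X :: "real^'d^'m"
  by (simp add: row_avg_def)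

lemma row_avg_add [simp]: "row_avg (X + Y) = row_avg X + row_avg Y"
  by (simp add: row_avg_def sum.distrib scaleR_right_distrib)

lemma row_avg_diff [simp]: "row_avg (X - Y) = row_avg X - row_avg Y"
  by (simp add: row_avg_def sum_subtractf scaleR_right_diff_distrib)

lemma row_avg_scaleR [simp]: "row_avg (c *\<^sub>R X) = c *\<^sub>R row_avg X"
  by (simp add: row_avg_def scaleR_sum_right[symmetric] scaleR_left_commute)

lemma row_avg_rep_rows [simp]: "row_avg (rep_rows v) = v"
  by (simp add: row_avg_def rep_rows_def sum_constant_scaleR del: sum_constant)

lemma rep_rows_nth [simp]: "rep_rows v $ i = v"
  by (simp add: rep_rows_def)

lemma Proj_rep_rows [simp]: "Proj ** rep_rows v = 0"
  by (simp add: Proj_mult_eq)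

lemma norm_sq_eq_sum_rows: "(norm X)\<^sup>2 = (\<Sum>i\<in>UNIV. (norm (X $ i))\<^sup>2)"
  for X :: "real^'d^'m"
  unfolding power2_norm_eq_inner inner_vec_def[of X] ..

lemma grad_rows_nth [simp]: "grad_rows f X $ i = grad (f i) (X $ i)"
  by (simp add: grad_rows_def)

lemma prox_rows_nth [simp]: "prox_rows \<gamma> g X $ i = prox \<gamma> g (X $ i)"
  by (simp add: prox_rows_def)

lemma inner_rep_rows: "X \<bullet> rep_rows v = real CARD('m) * (row_avg X \<bullet> v)"
  for X :: "real^'d^'m"
  by (simp add: inner_vec_def[of X] inner_sum_left[symmetric] sum_rows)

text \<open>The space of matrices is the orthogonal sum of those with equal rows and those with zero row
  average.\<close>

lemma inner_Proj_decomposition: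
  fixes X Y :: "real^'d^'m"
  shows "X \<bullet> Y = real CARD('m) * (row_avg X \<bullet> row_avg Y) + (Proj ** X) \<bullet> (Proj ** Y)"
  unfolding Proj_mult_eq
  by (simp add: inner_diff_left inner_diff_right inner_rep_rows
      inner_commute[of "rep_rows _" Y] inner_commute[of "row_avg Y" "row_avg X"])

lemma Proj_diff: "Proj ** (X - Y) = Proj ** X - Proj ** Y"
  by (simp add: Proj_mult_eq rep_rows_def vec_eq_iff)

lemma norm_Proj_decomposition:
  fixes X :: "real^'d^'m"
  shows "(norm (X - rep_rows v))\<^sup>2 = real CARD('m) * (norm (row_avg X - v))\<^sup>2 + (norm (Proj ** X))\<^sup>2"
  using inner_Proj_decomposition[of "X - rep_rows v" "X - rep_rows v"]
  by (simp add: power2_norm_eq_inner Proj_diff)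

lemma norm_row_avg_le: "real CARD('m) * (norm (row_avg X))\<^sup>2 \<le> (norm X)\<^sup>2"
  for X :: "real^'d^'m"
  using norm_Proj_decomposition[of X 0] by (simp add: rep_rows_def zero_vec_def[symmetric])

lemma norm_Proj_le_diff_rep_rows: "norm (Proj ** X) \<le> norm (X - rep_rows v)"
  for X :: "real^'d^'m"
  by (rule power2_le_imp_le) (simp_all add: norm_Proj_decomposition)

lemma norm_Proj_le: "norm (Proj ** X) \<le> norm X"
  for X :: "real^'d^'m"
  using norm_Proj_le_diff_rep_rows[of X 0] by (simp add: rep_rows_def zero_vec_def[symmetric])

lemma Proj_add: "Proj ** (X + Y) = Proj ** X + Proj ** Y"
  by (simp add: matrix_add_ldistrib)

lemma Proj_scaleR: "Proj ** (c *\<^sub>R X) = c *\<^sub>R (Proj ** X)"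
  by (simp add: Proj_mult_eq vec_eq_iff algebra_simps)

section \<open>Consensus contraction by FastMix\<close>

lemma row_avg_weight_mult:
  fixes X :: "real^'d^'m"
  assumes "transpose W = W" "W *v 1 = 1"
  shows "row_avg (W ** X) = row_avg X"
proof -
  have col: "(\<Sum>i\<in>UNIV. W $ i $ k) = 1" for k
  proof -
    have "(\<Sum>i\<in>UNIV. W $ i $ k) = (transpose W *v 1) $ k"
      by (simp add: matrix_vector_mult_def transpose_def)
    then show ?thesis using assms by simp
  qed
  have "(\<Sum>i\<in>UNIV. (W ** X) $ i) $ j = (\<Sum>k\<in>UNIV. X $ k) $ j" for j
  proof -
    have "(\<Sum>i\<in>UNIV. (W ** X) $ i) $ j = (\<Sum>i\<in>UNIV. \<Sum>k\<in>UNIV. W $ i $ k * X $ k $ j)"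
      by (simp add: matrix_matrix_mult_def)
    also have "\<dots> = (\<Sum>k\<in>UNIV. (\<Sum>i\<in>UNIV. W $ i $ k) * X $ k $ j)"
      by (subst sum.swap) (simp add: sum_distrib_right)
    finally show ?thesis by (simp add: col)
  qed
  then show ?thesis by (simp add: row_avg_def vec_eq_iff)
qed

lemma row_avg_FastMix:
  assumes "weight_matrix E W"
  shows "row_avg (FastMix W X K) = row_avg X"
proof -
  have W: "transpose W = W" "W *v 1 = 1" using assms by (auto simp: weight_matrix_def)
  have "row_avg (fastmix_iter W \<eta> X k) = row_avg X" for \<eta> k
    by (induction k rule: induct_nat_012)
      (simp_all add: row_avg_weight_mult[OF W] scaleR_left_distrib)
  then show ?thesis by (simp add: FastMix_def)
qed

lemma norm_sq_eq_sum_columns: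
  fixes X :: "real^'d^'m"
  shows "(norm X)\<^sup>2 = (\<Sum>j\<in>UNIV. (norm (column j X))\<^sup>2)"
proof -
  have "(norm X)\<^sup>2 = (\<Sum>i\<in>UNIV. \<Sum>j\<in>UNIV. (X $ i $ j)\<^sup>2)"
    unfolding power2_norm_eq_inner inner_vec_def by (simp add: power2_eq_square)
  also have "\<dots> = (\<Sum>j\<in>UNIV. \<Sum>i\<in>UNIV. (X $ i $ j)\<^sup>2)" by (rule sum.swap)
  finally show ?thesis
    unfolding power2_norm_eq_inner inner_vec_def by (simp add: power2_eq_square column_def)
qed

lemma column_mult: "column j (A ** X) = A *v column j X"
  by (simp add: vec_eq_iff column_def matrix_matrix_mult_def matrix_vector_mult_def)

lemma fastmix_iter_eigen_coeff:
  fixes W :: "real^'m^'m"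
  assumes "transpose W = W" "W *v b = l *\<^sub>R b"
  shows "b \<bullet> column j (fastmix_iter W \<eta> X k) = momentum_poly \<eta> l k * (b \<bullet> column j X)"
proof (induction k rule: induct_nat_012)
  case (ge2 k)
  have "column j (fastmix_iter W \<eta> X (Suc (Suc k)))
      = (1 + \<eta>) *\<^sub>R (W *v column j (fastmix_iter W \<eta> X (Suc k)))
        - \<eta> *\<^sub>R column j (fastmix_iter W \<eta> X k)"
    by (simp add: column_mult[symmetric]) (simp add: vec_eq_iff column_def)
  then have "b \<bullet> column j (fastmix_iter W \<eta> X (Suc (Suc k)))
      = (1 + \<eta>) * (l * (b \<bullet> column j (fastmix_iter W \<eta> X (Suc k))))
        - \<eta> * (b \<bullet> column j (fastmix_iter W \<eta> X k))"
    using sym_matrix_inner[OF assms(1), of b] assms(2) by (simp only: inner_diff_right inner_scaleR_right inner_scaleR_left)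
  then show ?case unfolding ge2 by (simp add: algebra_simps)
qed auto

text \<open>Each column of \<open>Proj ** X\<close> is the part of the column of \<open>X\<close> orthogonal to the all-ones vector.
  In an orthonormal eigenbasis \<open>B\<close> of that complement its coefficients are those of the column of
  \<open>X\<close>, and FastMix multiplies each of them by a small number.  When there is a single agent, \<open>B\<close> is
  empty and both sides vanish.\<close>

lemma norm_Proj_FastMix_le:
  fixes X :: "real^'d^'m"
  assumes W: "weight_matrix E W" and K: "K = nat \<lceil>15 / sqrt (1 - lambda2 W)\<rceil>"
  shows "(norm (Proj ** FastMix W X K))\<^sup>2 \<le> (norm (Proj ** X))\<^sup>2 / 8192"
proof -
  have sym: "transpose W = W" and W1: "W *v 1 = 1" using W by (auto simp: weight_matrix_def)
  define S where "S = {v :: real^'m. v \<bullet> 1 = 0}"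
  have S: "subspace S" by (auto simp: S_def subspace_def inner_add_left)
  have "W *v v \<in> S" if "v \<in> S" for v
    using that sym_matrix_inner[OF sym, of v 1] W1 by (simp add: S_def)
  from sym_matrix_eigenbasis[OF sym S this] obtain B where B: "finite B" "pairwise orthogonal B"
    "B \<subseteq> S" "span B = S" "\<And>b. b \<in> B \<Longrightarrow> norm b = 1" "\<And>b. b \<in> B \<Longrightarrow> \<exists>l. W *v b = l *\<^sub>R b"
    by blast
  have parseval: "(norm (Proj ** Y))\<^sup>2 = (\<Sum>j\<in>UNIV. \<Sum>b\<in>B. (b \<bullet> column j Y)\<^sup>2)"
    for Y :: "real^'d^'m"
  proof -
    have col: "column j (Proj ** Y) = column j Y - (row_avg Y $ j) *\<^sub>R 1" for j
      by (simp add: Proj_mult_eq vec_eq_iff column_def)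
    have "(\<Sum>i\<in>UNIV. (Proj ** Y) $ i $ j) = 0" for j
      using sum_rows[of "Proj ** Y"] arg_cong[of _ _ "\<lambda>v. v $ j"]
      by (simp add: Proj_mult_eq sum_subtractf row_avg_def)
    then have inS: "column j (Proj ** Y) \<in> S" for j
      by (simp add: S_def inner_vec_def column_def)
    have "(norm (column j (Proj ** Y)))\<^sup>2 = (\<Sum>b\<in>B. (b \<bullet> column j (Proj ** Y))\<^sup>2)" for j
      by (rule norm_sq_eq_sum_orthonormal_coeffs) (use B inS in auto)
    moreover have "b \<bullet> column j (Proj ** Y) = b \<bullet> column j Y" if "b \<in> B" for b j
    proof -
      have "b \<bullet> 1 = 0" using B(3) that by (auto simp: S_def)
      then show ?thesis unfolding col by (simp add: inner_diff_right)
    qed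
    ultimately show ?thesis by (simp add: norm_sq_eq_sum_columns)
  qed
  have coeff: "(b \<bullet> column j (FastMix W X K))\<^sup>2 \<le> (b \<bullet> column j X)\<^sup>2 / 8192" if b: "b \<in> B" for b j
  proof -
    obtain l where l: "W *v b = l *\<^sub>R b" using B(6)[OF b] by blast
    have b': "b \<noteq> 0" "b \<bullet> 1 = 0" using B(3) B(5)[OF b] b by (auto simp: S_def)
    let ?p = "momentum_poly (1 / (1 + sqrt (1 - (lambda2 W)\<^sup>2))) l K"
    have "?p\<^sup>2 \<le> 1 / 8192"
      by (rule momentum_poly_small[OF _ _ _ K]) (rule eigenvalue_orthogonal_to_ones[OF W b' l])+
    then have "?p\<^sup>2 * (b \<bullet> column j X)\<^sup>2 \<le> 1 / 8192 * (b \<bullet> column j X)\<^sup>2"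
      by (rule mult_right_mono) simp
    then show ?thesis unfolding FastMix_def fastmix_iter_eigen_coeff[OF sym l]
      by (simp add: power_mult_distrib)
  qed
  have "(norm (Proj ** FastMix W X K))\<^sup>2 \<le> (\<Sum>j\<in>UNIV. \<Sum>b\<in>B. (b \<bullet> column j X)\<^sup>2 / 8192)"
    unfolding parseval by (intro sum_mono coeff)
  also have "\<dots> = (norm (Proj ** X))\<^sup>2 / 8192"
    unfolding parseval by (simp add: sum_divide_distrib)
  finally show ?thesis .
qed

section \<open>Smooth convex functions and proximal maps\<close>

lemma convex_smoothD:
  assumes "convex_smooth L f"
  shows "f y \<ge> f x + grad f x \<bullet> (y - x)"
    and "f y \<le> f x + grad f x \<bullet> (y - x) + L / 2 * (norm (y - x))\<^sup>2"
  using assms by (auto simp: convex_smooth_def norm_minus_commute)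

text \<open>Compare the convexity bound at \<open>x\<close> and the smoothness bound at \<open>y\<close>, both evaluated at the point
  reached from \<open>y\<close> by a gradient step of length \<open>1 / L\<close> for \<open>f\<close> minus its linearization at \<open>x\<close>.\<close>

lemma convex_smooth_bregman_lower:
  assumes f: "convex_smooth L f" and L: "0 < L"
  shows "f y \<ge> f x + grad f x \<bullet> (y - x) + 1 / (2 * L) * (norm (grad f y - grad f x))\<^sup>2"
proof -
  define d where "d = grad f y - grad f x"
  define w where "w = y - (1 / L) *\<^sub>R d"
  have "f x + grad f x \<bullet> (w - x) \<le> f w" by (rule convex_smoothD(1)[OF f])
  also have "\<dots> \<le> f y + grad f y \<bullet> (w - y) + L / 2 * (norm (w - y))\<^sup>2" by (rule convex_smoothD(2)[OF f])
  also have "(norm (w - y))\<^sup>2 = (d \<bullet> d) / L\<^sup>2"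
    using L by (simp add: w_def power_divide power2_norm_eq_inner[symmetric])
  finally have "f x + grad f x \<bullet> (w - x) \<le> f y + grad f y \<bullet> (w - y) + (d \<bullet> d) / (2 * L)"
    using L by (simp add: power2_eq_square)
  moreover have "grad f x \<bullet> (w - x) = grad f x \<bullet> (y - x) - (grad f x \<bullet> d) / L"
    by (simp add: w_def inner_diff_right)
  moreover have "grad f y \<bullet> (w - y) = - (d \<bullet> d) / L - (grad f x \<bullet> d) / L"
    by (simp add: w_def d_def inner_diff_right inner_diff_left diff_divide_distrib)
  ultimately have "f x + grad f x \<bullet> (y - x) + (d \<bullet> d) / (2 * L) \<le> f y"
    by (simp add: field_simps)
  then show ?thesis by (simp add: d_def power2_norm_eq_inner)
qed

text \<open>Adding the refined convexity inequality to itself with \<open>x\<close> and \<open>y\<close> exchanged shows that the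
  gradient is cocoercive; Cauchy-Schwarz does the rest.\<close>

lemma grad_lipschitz:
  assumes f: "convex_smooth L f" and L: "0 < L"
  shows "norm (grad f y - grad f x) \<le> L * norm (y - x)"
proof -
  define d where "d = grad f y - grad f x"
  have "f y \<ge> f x + grad f x \<bullet> (y - x) + 1 / (2 * L) * (norm d)\<^sup>2"
    unfolding d_def by (rule convex_smooth_bregman_lower[OF f L])
  moreover have "f x \<ge> f y + grad f y \<bullet> (x - y) + 1 / (2 * L) * (norm d)\<^sup>2"
    unfolding d_def norm_minus_commute[of "grad f y"] by (rule convex_smooth_bregman_lower[OF f L])
  ultimately have "1 / L * (norm d)\<^sup>2 \<le> d \<bullet> (y - x)"
    by (simp add: d_def inner_diff_left inner_diff_right)
  also have "\<dots> \<le> norm d * norm (y - x)" by (rule norm_cauchy_schwarz)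
  finally have "norm d * norm d \<le> norm d * (L * norm (y - x))"
    using L by (simp add: field_simps power2_eq_square)
  then show ?thesis unfolding d_def[symmetric]
    using L by (cases "norm d = 0") (auto simp: mult_le_cancel_left)
qed

text \<open>The optimality condition for a sum of which one summand is only known to lie below a parabola
  touching it at \<open>p\<close>: minimality along the segment from \<open>p\<close> to \<open>w\<close>, divided by the step length, gives the
  subgradient inequality up to a term that vanishes with the step.  It serves both for the proximal
  map and for the minimizer of the objective.\<close>

lemma minimizer_subgradient:
  fixes g \<phi> :: "'a::real_inner \<Rightarrow> real"
  assumes g: "convex_on UNIV g"
    and \<phi>: "\<And>w. \<phi> w \<le> \<phi> p + v \<bullet> (w - p) + c * (norm (w - p))\<^sup>2"
    and min: "\<And>w. \<phi> p + g p \<le> \<phi> w + g w"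
  shows "is_subgradient g p (- v)"
  unfolding is_subgradient_def
proof
  fix w
  let ?A = "g w - g p + v \<bullet> (w - p)" and ?B = "c * (norm (w - p))\<^sup>2"
  have "0 \<le> ?A + t * ?B" if t: "0 < t" "t \<le> 1" for t
  proof -
    let ?w = "(1 - t) *\<^sub>R p + t *\<^sub>R w"
    have "?w - p = t *\<^sub>R (w - p)" by (simp add: algebra_simps)
    then have "\<phi> ?w \<le> \<phi> p + t * (v \<bullet> (w - p)) + c * (t * norm (w - p))\<^sup>2"
      using \<phi>[of ?w] t by simp
    moreover have "g ?w \<le> (1 - t) * g p + t * g w"
      using t by (intro convex_onD[OF g]) auto
    ultimately have "0 \<le> t * (?A + t * ?B)"
      using min[of ?w] by (simp add: algebra_simps power2_eq_square)
    then show ?thesis using t by (simp add: zero_le_mult_iff)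
  qed
  moreover have "((\<lambda>t. ?A + t * ?B) \<longlongrightarrow> ?A + 0 * ?B) (at_right 0)"
    by (intro tendsto_intros)
  moreover have "\<forall>\<^sub>F t in at_right (0::real). 0 < t \<and> t \<le> 1"
    unfolding eventually_at_right_field by (intro exI[of _ 1]) auto
  ultimately have "0 \<le> ?A + 0 * ?B"
    by (intro tendsto_lowerbound) (auto elim: eventually_mono)
  then show "g p + - v \<bullet> (w - p) \<le> g w" by simp
qed

text \<open>The affine minorant given by one subgradient bounds the proximal objective below by a parabola with
  vertex \<open>p\<close>, so a minimum over a large ball around \<open>p\<close> is global.\<close>

lemma prox_is_minimizer:
  fixes g :: "'a::euclidean_space \<Rightarrow> real"
  assumes g: "convex_on UNIV g" and \<gamma>: "0 < \<gamma>" and sub: "is_subgradient g a u"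
  shows "\<gamma> * g (prox \<gamma> g v) + 1 / 2 * (norm (prox \<gamma> g v - v))\<^sup>2 \<le> \<gamma> * g w + 1 / 2 * (norm (w - v))\<^sup>2"
proof -
  define \<psi> where "\<psi> w = \<gamma> * g w + 1 / 2 * (norm (w - v))\<^sup>2" for w
  define p where "p = v - \<gamma> *\<^sub>R u"
  define C where "C = \<gamma> * (g a + u \<bullet> (v - a)) - \<gamma>\<^sup>2 / 2 * (u \<bullet> u)"
  have lower: "C + 1 / 2 * (norm (w - p))\<^sup>2 \<le> \<psi> w" for w
  proof -
    have "\<gamma> * (g a + u \<bullet> (w - a)) \<le> \<gamma> * g w"
      using sub \<gamma> by (intro mult_left_mono) (auto simp: is_subgradient_def)
    moreover have "\<gamma> * (g a + u \<bullet> (w - a)) + 1 / 2 * (norm (w - v))\<^sup>2 = C + 1 / 2 * (norm (w - p))\<^sup>2"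
      unfolding C_def p_def power2_norm_eq_inner
      by (simp add: inner_diff_left inner_diff_right inner_commute algebra_simps)
        (simp add: power2_eq_square)
    ultimately show ?thesis by (simp add: \<psi>_def)
  qed
  \<comment> \<open>outside the ball of radius \<open>R \<ge> 1\<close> the parabola exceeds \<open>\<psi> p\<close>\<close>
  define R where "R = 1 + 2 * \<bar>\<psi> p - C\<bar>"
  have cont: "continuous_on (cball p R) \<psi>"
    unfolding \<psi>_def using convex_on_continuous[OF open_UNIV g]
    by (intro continuous_intros) (auto intro: continuous_on_subset)
  have "p \<in> cball p R" by (simp add: R_def)
  then obtain q where q: "q \<in> cball p R" and q_min: "\<And>w. w \<in> cball p R \<Longrightarrow> \<psi> q \<le> \<psi> w"
    using continuous_attains_inf[OF compact_cball _ cont] by blast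
  have "\<psi> q \<le> \<psi> w" for w
  proof (cases "w \<in> cball p R")
    case False
    then have far: "R \<le> norm (w - p)" by (simp add: dist_norm norm_minus_commute)
    have "1 * R \<le> R * R" by (intro mult_right_mono) (auto simp: R_def)
    then have "R \<le> R * R" by simp
    also have "\<dots> \<le> (norm (w - p))\<^sup>2" unfolding power2_eq_square
      using far by (intro mult_mono) (auto simp: R_def)
    finally have "1 + 2 * \<bar>\<psi> p - C\<bar> \<le> (norm (w - p))\<^sup>2" by (simp add: R_def)
    then have "\<psi> p \<le> \<psi> w" using lower[of w] by (auto simp: abs_if split: if_splits)
    then show ?thesis using q_min[OF \<open>p \<in> cball p R\<close>] by linarith
  qed (rule q_min)
  then have "is_arg_min \<psi> (\<lambda>w. True) q" by (simp add: is_arg_min_linorder)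
  then have "is_arg_min \<psi> (\<lambda>w. True) (arg_min \<psi> (\<lambda>w. True))"
    unfolding arg_min_def by (rule someI)
  moreover have "arg_min \<psi> (\<lambda>w. True) = prox \<gamma> g v"
    by (simp add: prox_def \<psi>_def[abs_def])
  ultimately have "\<psi> (prox \<gamma> g v) \<le> \<psi> w" by (simp add: is_arg_min_linorder)
  then show ?thesis by (simp add: \<psi>_def)
qed

lemma prox_subgradient:
  fixes g :: "'a::euclidean_space \<Rightarrow> real"
  assumes g: "convex_on UNIV g" and \<gamma>: "0 < \<gamma>" and sub: "is_subgradient g a u"
  shows "is_subgradient g (prox \<gamma> g v) ((1 / \<gamma>) *\<^sub>R (v - prox \<gamma> g v))"
proof -
  let ?p = "prox \<gamma> g v"
  let ?\<phi> = "\<lambda>w. 1 / (2 * \<gamma>) * (norm (w - v))\<^sup>2"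
  have "is_subgradient g ?p (- ((1 / \<gamma>) *\<^sub>R (?p - v)))"
  proof (rule minimizer_subgradient[where \<phi> = ?\<phi> and c = "1 / (2 * \<gamma>)", OF g])
    fix w
    have "(norm (w - v))\<^sup>2 = (norm (?p - v))\<^sup>2 + 2 * ((?p - v) \<bullet> (w - ?p)) + (norm (w - ?p))\<^sup>2"
      by (simp add: power2_norm_eq_inner inner_diff_left inner_diff_right inner_commute)
    then show "?\<phi> w \<le> ?\<phi> ?p + (1 / \<gamma>) *\<^sub>R (?p - v) \<bullet> (w - ?p) + 1 / (2 * \<gamma>) * (norm (w - ?p))\<^sup>2"
      using \<gamma> unfolding inner_scaleR_left by (simp add: field_simps)
    show "?\<phi> ?p + g ?p \<le> ?\<phi> w + g w"
      using divide_right_mono[OF prox_is_minimizer[OF g \<gamma> sub, of v w], of \<gamma>] \<gamma>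
      by (simp add: add_divide_distrib add.commute mult.commute)
  qed
  then show ?thesis by (simp add: algebra_simps)
qed

lemma prox_nonexpansive:
  fixes g :: "'a::euclidean_space \<Rightarrow> real"
  assumes g: "convex_on UNIV g" and \<gamma>: "0 < \<gamma>" and sub: "is_subgradient g a u"
  shows "norm (prox \<gamma> g v - prox \<gamma> g w) \<le> norm (v - w)"
proof -
  let ?p = "prox \<gamma> g v" and ?q = "prox \<gamma> g w"
  have "g ?q \<ge> g ?p + ((1 / \<gamma>) *\<^sub>R (v - ?p)) \<bullet> (?q - ?p)"
    and "g ?p \<ge> g ?q + ((1 / \<gamma>) *\<^sub>R (w - ?q)) \<bullet> (?p - ?q)"
    using prox_subgradient[OF g \<gamma> sub] unfolding is_subgradient_def by blast+
  then have "(1 / \<gamma>) * ((v - ?p) \<bullet> (?q - ?p) + (w - ?q) \<bullet> (?p - ?q)) \<le> 0"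
    by (simp add: algebra_simps)
  then have "(v - ?p) \<bullet> (?q - ?p) + (w - ?q) \<bullet> (?p - ?q) \<le> 0"
    using \<gamma> by (simp add: divide_le_0_iff)
  then have "(norm (?p - ?q))\<^sup>2 \<le> (v - w) \<bullet> (?p - ?q)"
    by (simp add: power2_norm_eq_inner inner_diff_left inner_diff_right inner_commute)
  also have "\<dots> \<le> norm (v - w) * norm (?p - ?q)" by (rule norm_cauchy_schwarz)
  finally show ?thesis
    by (cases "norm (?p - ?q) = 0") (auto simp: power2_eq_square mult_le_cancel_right)
qed

section \<open>One step of the accelerated method with inexact gradients\<close>

lemma avg_fun_sum: "real CARD('m) * avg_fun f w = (\<Sum>i\<in>UNIV. f i w)"
  for f :: "'m::finite \<Rightarrow> real^'d \<Rightarrow> real"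
  by (simp add: avg_fun_def)

lemma sum_bregman_lower:
  fixes f :: "'m::finite \<Rightarrow> real^'d \<Rightarrow> real"
  assumes "\<And>i. convex_smooth L (f i)" "0 < L"
  shows "(\<Sum>i\<in>UNIV. f i (X $ i)) + grad_rows f X \<bullet> (Y - X)
      + 1 / (2 * L) * (norm (grad_rows f Y - grad_rows f X))\<^sup>2 \<le> (\<Sum>i\<in>UNIV. f i (Y $ i))"
proof -
  have "(\<Sum>i\<in>UNIV. f i (X $ i) + grad (f i) (X $ i) \<bullet> (Y $ i - X $ i)
      + 1 / (2 * L) * (norm (grad (f i) (Y $ i) - grad (f i) (X $ i)))\<^sup>2) \<le> (\<Sum>i\<in>UNIV. f i (Y $ i))"
    by (intro sum_mono convex_smooth_bregman_lower assms)
  then show ?thesis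
    by (simp add: sum.distrib norm_sq_eq_sum_rows inner_vec_def[of "grad_rows f X"] sum_distrib_left)
qed

lemma sum_smooth_upper:
  fixes f :: "'m::finite \<Rightarrow> real^'d \<Rightarrow> real"
  assumes "\<And>i. convex_smooth L (f i)"
  shows "(\<Sum>i\<in>UNIV. f i (Y $ i)) \<le> (\<Sum>i\<in>UNIV. f i (X $ i)) + grad_rows f X \<bullet> (Y - X)
      + L / 2 * (norm (Y - X))\<^sup>2"
proof -
  have "(\<Sum>i\<in>UNIV. f i (Y $ i)) \<le> (\<Sum>i\<in>UNIV. f i (X $ i) + grad (f i) (X $ i) \<bullet> (Y $ i - X $ i)
      + L / 2 * (norm (Y $ i - X $ i))\<^sup>2)"
    by (intro sum_mono convex_smoothD assms)
  then show ?thesis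
    by (simp add: sum.distrib norm_sq_eq_sum_rows inner_vec_def[of "grad_rows f X"] sum_distrib_left)
qed

lemma grad_rows_lipschitz:
  assumes "\<And>i. convex_smooth L (f i)" "0 < L"
  shows "norm (grad_rows f X - grad_rows f Y) \<le> L * norm (X - Y)"
proof (rule power2_le_imp_le)
  have "(norm (grad_rows f X - grad_rows f Y))\<^sup>2 \<le> (\<Sum>i\<in>UNIV. (L * norm (X $ i - Y $ i))\<^sup>2)"
    unfolding norm_sq_eq_sum_rows by (intro sum_mono power_mono) (simp_all add: grad_lipschitz assms)
  then show "(norm (grad_rows f X - grad_rows f Y))\<^sup>2 \<le> (L * norm (X - Y))\<^sup>2"
    by (simp add: norm_sq_eq_sum_rows power_mult_distrib sum_distrib_left)
qed (use assms in simp)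

text \<open>The sum of the linearizations of the \<open>f i\<close> at the agents' points \<open>X $ i\<close> is an affine function
  whose gradient is the sum of the agents' gradients.  It lies below \<open>CARD('m) * avg_fun f\<close> with a
  Bregman gap, and above it up to a quadratic error in which the disagreement of the agents enters as
  \<open>(norm (Proj ** X))\<^sup>2\<close>.  Evaluating the lower bound at \<open>y\<close> and \<open>w\<close> and the upper bound at the new point gives
  the estimate of an accelerated step with exact gradients plus this error.  The Bregman gap at \<open>y\<close>
  is kept, since it later pays for the gradient tracking error.\<close>

lemma inexact_accelerated_descent:
  fixes f :: "'m::finite \<Rightarrow> real^'d \<Rightarrow> real" and X :: "real^'d^'m" and w y z z' :: "real^'d"
  assumes f: "\<And>i. convex_smooth L (f i)" and L: "0 < L" and \<tau>: "0 \<le> \<tau>" "\<tau> \<le> 1"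
    and X: "row_avg X = \<tau> *\<^sub>R z + (1 - \<tau>) *\<^sub>R y"
  shows "real CARD('m) * avg_fun f (\<tau> *\<^sub>R z' + (1 - \<tau>) *\<^sub>R y)
    \<le> (1 - \<tau>) * (real CARD('m) * avg_fun f y) + \<tau> * (real CARD('m) * avg_fun f w)
      + \<tau> * (real CARD('m) * (row_avg (grad_rows f X) \<bullet> (z' - w)))
      + L / 2 * (real CARD('m) * (\<tau> * norm (z' - z))\<^sup>2 + (norm (Proj ** X))\<^sup>2)
      - (1 - \<tau>) / (2 * L) * (norm (grad_rows f (rep_rows y) - grad_rows f X))\<^sup>2"
proof -
  let ?m = "real CARD('m)"
  let ?G = "grad_rows f X"
  let ?y' = "\<tau> *\<^sub>R z' + (1 - \<tau>) *\<^sub>R y"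
  define b where "b = row_avg ?G"
  define c where "c = (\<Sum>i\<in>UNIV. f i (X $ i)) - ?G \<bullet> X"
  have lin: "?G \<bullet> (rep_rows v - X) = ?m * (b \<bullet> v) - ?G \<bullet> X" for v
    by (simp add: b_def inner_diff_right inner_rep_rows)
  have low: "c + ?m * (b \<bullet> v) + 1 / (2 * L) * (norm (grad_rows f (rep_rows v) - ?G))\<^sup>2
      \<le> ?m * avg_fun f v" for v
    using sum_bregman_lower[of L f X "rep_rows v", OF f L] by (simp add: lin c_def avg_fun_sum)
  have dist: "(norm (rep_rows ?y' - X))\<^sup>2 = ?m * (\<tau> * norm (z' - z))\<^sup>2 + (norm (Proj ** X))\<^sup>2"
  proof -
    have "row_avg X - ?y' = \<tau> *\<^sub>R (z - z')" unfolding X by (simp add: algebra_simps)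
    then have "norm (row_avg X - ?y') = \<tau> * norm (z' - z)" using \<tau> by (simp add: norm_minus_commute)
    then show ?thesis
      unfolding norm_minus_commute[of "rep_rows ?y'"] norm_Proj_decomposition by simp
  qed
  have "?m * avg_fun f ?y' \<le> c + ?m * (b \<bullet> ?y') + L / 2 * (norm (rep_rows ?y' - X))\<^sup>2"
    using sum_smooth_upper[of L f "rep_rows ?y'" X, OF f] by (simp add: lin c_def avg_fun_sum)
  also have "c + ?m * (b \<bullet> ?y') = (1 - \<tau>) * (c + ?m * (b \<bullet> y)) + \<tau> * (c + ?m * (b \<bullet> w))
      + \<tau> * (?m * (b \<bullet> (z' - w)))"
    by (simp add: inner_add_right inner_diff_right algebra_simps)
  also have "(1 - \<tau>) * (c + ?m * (b \<bullet> y)) \<le> (1 - \<tau>) * (?m * avg_fun f y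
      - 1 / (2 * L) * (norm (grad_rows f (rep_rows y) - ?G))\<^sup>2)"
    using low[of y] \<tau> by (intro mult_left_mono) auto
  also have "\<tau> * (c + ?m * (b \<bullet> w)) \<le> \<tau> * (?m * avg_fun f w)"
  proof (rule mult_left_mono)
    have "0 \<le> 1 / (2 * L) * (norm (grad_rows f (rep_rows w) - ?G))\<^sup>2" using L by simp
    then show "c + ?m * (b \<bullet> w) \<le> ?m * avg_fun f w" using low[of w] by linarith
  qed (rule \<tau>)
  finally show ?thesis
    unfolding dist b_def by (simp add: right_diff_distrib)
qed

lemma convex_row_avg_le:
  fixes X :: "real^'d^'m"
  assumes "convex_on UNIV g"
  shows "real CARD('m) * g (row_avg X) \<le> (\<Sum>i\<in>UNIV. g (X $ i))"
proof -
  have "g (\<Sum>i\<in>UNIV. (1 / real CARD('m)) *\<^sub>R (X $ i)) \<le> (\<Sum>i\<in>UNIV. 1 / real CARD('m) * g (X $ i))"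
    by (rule convex_on_sum[OF _ _ assms]) auto
  then have "g (row_avg X) \<le> 1 / real CARD('m) * (\<Sum>i\<in>UNIV. g (X $ i))"
    by (simp add: row_avg_def scaleR_sum_right sum_distrib_left)
  then show ?thesis by (simp add: field_simps)
qed

lemma prox_rows_inequality:
  fixes g :: "real^'d \<Rightarrow> real" and U :: "real^'d^'m"
  assumes g: "strongly_convex \<mu> g" and sub: "is_subgradient g a u" and \<gamma>: "0 < \<gamma>"
  defines "Z \<equiv> prox_rows \<gamma> g U"
  shows "(\<Sum>i\<in>UNIV. g (Z $ i)) \<le> real CARD('m) * g w + 1 / \<gamma> * ((U - Z) \<bullet> (Z - rep_rows w))
    - \<mu> / 2 * (norm (Z - rep_rows w))\<^sup>2"
proof -
  have conv: "convex_on UNIV g" using g by (simp add: strongly_convex_def)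
  have "g (Z $ i) \<le> g w + 1 / \<gamma> * ((U $ i - Z $ i) \<bullet> (Z $ i - w)) - \<mu> / 2 * (norm (Z $ i - w))\<^sup>2" for i
  proof -
    have "is_subgradient g (Z $ i) ((1 / \<gamma>) *\<^sub>R (U $ i - Z $ i))"
      using prox_subgradient[OF conv \<gamma> sub, of "U $ i"] by (simp add: Z_def)
    then have "g (Z $ i) + ((1 / \<gamma>) *\<^sub>R (U $ i - Z $ i)) \<bullet> (w - Z $ i) + \<mu> / 2 * (norm (w - Z $ i))\<^sup>2 \<le> g w"
      using g unfolding strongly_convex_def by blast
    moreover have "(U $ i - Z $ i) \<bullet> (w - Z $ i) = - ((U $ i - Z $ i) \<bullet> (Z $ i - w))"
      by (simp add: inner_diff_right)
    ultimately show ?thesis by (simp add: norm_minus_commute)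
  qed
  then have "(\<Sum>i\<in>UNIV. g (Z $ i))
      \<le> (\<Sum>i\<in>UNIV. g w + 1 / \<gamma> * ((U $ i - Z $ i) \<bullet> (Z $ i - w)) - \<mu> / 2 * (norm (Z $ i - w))\<^sup>2)"
    by (rule sum_mono)
  also have "\<dots> = real CARD('m) * g w + 1 / \<gamma> * (\<Sum>i\<in>UNIV. (U $ i - Z $ i) \<bullet> (Z $ i - w))
      - \<mu> / 2 * (\<Sum>i\<in>UNIV. (norm (Z $ i - w))\<^sup>2)"
    by (simp only: sum.distrib sum_subtractf sum_distrib_left[symmetric]) simp
  also have "\<dots> = real CARD('m) * g w + 1 / \<gamma> * ((U - Z) \<bullet> (Z - rep_rows w))
      - \<mu> / 2 * (norm (Z - rep_rows w))\<^sup>2"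
    by (simp add: norm_sq_eq_sum_rows[of "Z - rep_rows w"] inner_vec_def[of "U - Z"])
  finally show ?thesis .
qed

text \<open>The proximal map is nonexpansive, and the row average is the constant closest to the rows.\<close>

lemma norm_Proj_prox_rows_le:
  fixes U :: "real^'d^'m"
  assumes g: "convex_on UNIV g" and \<gamma>: "0 < \<gamma>" and sub: "is_subgradient g a u"
  shows "norm (Proj ** prox_rows \<gamma> g U) \<le> norm (Proj ** U)"
proof -
  let ?c = "prox \<gamma> g (row_avg U)"
  have "norm (Proj ** prox_rows \<gamma> g U) \<le> norm (prox_rows \<gamma> g U - rep_rows ?c)"
    by (rule norm_Proj_le_diff_rep_rows)
  also have "\<dots> \<le> norm (Proj ** U)"
  proof (rule power2_le_imp_le)
    show "(norm (prox_rows \<gamma> g U - rep_rows ?c))\<^sup>2 \<le> (norm (Proj ** U))\<^sup>2"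
      unfolding norm_sq_eq_sum_rows Proj_mult_eq
      by (intro sum_mono power_mono) (simp_all add: prox_nonexpansive[OF g \<gamma> sub])
  qed simp
  finally show ?thesis .
qed

text \<open>The descent estimate for \<open>f\<close> and the proximal inequality for \<open>g\<close>, both compared with \<open>w\<close>.  The
  linear terms of the two would cancel if all agents used the same gradient estimate; what is left is the
  covariance of the rows of \<open>s\<close> and \<open>Z\<close>, bounded by the product of their disagreements.  The factor
  \<open>1 + \<tau>\<close> on the left comes from the strong convexity of \<open>g\<close>.\<close>

lemma odapg_step_inequality:
  fixes f :: "'m::finite \<Rightarrow> real^'d \<Rightarrow> real" and g :: "real^'d \<Rightarrow> real"
    and x' y z s Z :: "real^'d^'m" and w :: "real^'d"
  defines "m \<equiv> real CARD('m)"
  assumes f: "\<And>i. convex_smooth L (f i)" and L: "0 < L"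
    and g: "strongly_convex \<mu> g" and sub: "is_subgradient g a u"
    and \<gamma>: "0 < \<gamma>" and \<tau>: "\<tau> = \<mu> * \<gamma>" "0 \<le> \<tau>" "\<tau> \<le> 1"
    and x': "x' = \<tau> *\<^sub>R z + (1 - \<tau>) *\<^sub>R y"
    and s: "row_avg s = row_avg (grad_rows f x')"
    and Z: "Z = prox_rows \<gamma> g (z - \<gamma> *\<^sub>R s)"
  shows "m * (objective f g (\<tau> *\<^sub>R row_avg Z + (1 - \<tau>) *\<^sub>R row_avg y) - objective f g w)
      + \<mu> / 2 * (1 + \<tau>) * (norm (Z - rep_rows w))\<^sup>2
    \<le> (1 - \<tau>) * (m * (objective f g (row_avg y) - objective f g w))
      + \<mu> / 2 * (norm (z - rep_rows w))\<^sup>2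
      - (\<mu> / 2 - L * \<tau>\<^sup>2 / 2) * (norm (Z - z))\<^sup>2
      + L / 2 * (norm (Proj ** x'))\<^sup>2 + \<tau> * (norm (Proj ** s) * norm (Proj ** Z))
      - (1 - \<tau>) / (2 * L) * (norm (grad_rows f (rep_rows (row_avg y)) - grad_rows f x'))\<^sup>2"
proof -
  have conv: "convex_on UNIV g" using g by (simp add: strongly_convex_def)
  let ?y' = "\<tau> *\<^sub>R row_avg Z + (1 - \<tau>) *\<^sub>R row_avg y"
  let ?P = "(norm (grad_rows f (rep_rows (row_avg y)) - grad_rows f x'))\<^sup>2"
  let ?D = "(norm (z - rep_rows w))\<^sup>2" and ?D' = "(norm (Z - rep_rows w))\<^sup>2" and ?\<Delta> = "(norm (Z - z))\<^sup>2"
  define I where "I = m * (row_avg s \<bullet> (row_avg Z - w))"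
  define J where "J = norm (Proj ** s) * norm (Proj ** Z)"
  have A: "m * avg_fun f ?y' \<le> (1 - \<tau>) * (m * avg_fun f (row_avg y)) + \<tau> * (m * avg_fun f w)
      + \<tau> * I + L / 2 * (m * (\<tau> * norm (row_avg Z - row_avg z))\<^sup>2 + (norm (Proj ** x'))\<^sup>2)
      - (1 - \<tau>) / (2 * L) * ?P"
    unfolding m_def I_def s by (rule inexact_accelerated_descent[OF f L \<tau>(2,3)]) (simp add: x')
  have "m * (\<tau> * norm (row_avg Z - row_avg z))\<^sup>2 = \<tau>\<^sup>2 * (m * (norm (row_avg (Z - z)))\<^sup>2)"
    by (simp add: power_mult_distrib)
  also have "\<dots> \<le> \<tau>\<^sup>2 * ?\<Delta>"
    unfolding m_def by (intro mult_left_mono norm_row_avg_le) simp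
  finally have B: "L / 2 * (m * (\<tau> * norm (row_avg Z - row_avg z))\<^sup>2 + (norm (Proj ** x'))\<^sup>2)
      \<le> L / 2 * (\<tau>\<^sup>2 * ?\<Delta> + (norm (Proj ** x'))\<^sup>2)"
    using L by (intro mult_left_mono) auto
  have "g ?y' \<le> \<tau> * g (row_avg Z) + (1 - \<tau>) * g (row_avg y)"
    using convex_onD[OF conv, of "1 - \<tau>" "row_avg Z" "row_avg y"] \<tau> by simp
  then have "m * g ?y' \<le> m * (\<tau> * g (row_avg Z) + (1 - \<tau>) * g (row_avg y))"
    unfolding m_def by (intro mult_left_mono) auto
  also have "\<dots> = \<tau> * (m * g (row_avg Z)) + (1 - \<tau>) * (m * g (row_avg y))"
    by (simp add: algebra_simps)
  also have "\<tau> * (m * g (row_avg Z)) \<le> \<tau> * (\<Sum>i\<in>UNIV. g (Z $ i))"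
    unfolding m_def using \<tau> by (intro mult_left_mono convex_row_avg_le[OF conv]) auto
  also have "\<tau> * (\<Sum>i\<in>UNIV. g (Z $ i)) \<le> \<tau> * (m * g w
      + 1 / \<gamma> * ((z - \<gamma> *\<^sub>R s - Z) \<bullet> (Z - rep_rows w)) - \<mu> / 2 * ?D')"
    unfolding m_def Z using \<tau> by (intro mult_left_mono prox_rows_inequality[OF g sub \<gamma>]) auto
  also have "(z - \<gamma> *\<^sub>R s - Z) \<bullet> (Z - rep_rows w)
      = 1 / 2 * (?D - ?D' - ?\<Delta>) - \<gamma> * (s \<bullet> (Z - rep_rows w))"
    by (simp add: power2_norm_eq_inner inner_diff_left inner_diff_right inner_commute algebra_simps)
  also have "\<tau> * (m * g w + 1 / \<gamma> * (1 / 2 * (?D - ?D' - ?\<Delta>) - \<gamma> * (s \<bullet> (Z - rep_rows w)))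
        - \<mu> / 2 * ?D')
      = \<tau> * (m * g w) + \<mu> / 2 * (?D - ?D' - ?\<Delta>) - \<tau> * (s \<bullet> (Z - rep_rows w)) - \<tau> * \<mu> / 2 * ?D'"
    using \<gamma> by (simp add: \<tau>(1) field_simps)
  finally have C: "m * g ?y' \<le> \<tau> * (m * g w) + \<mu> / 2 * (?D - ?D' - ?\<Delta>)
      - \<tau> * (s \<bullet> (Z - rep_rows w)) - \<tau> * \<mu> / 2 * ?D' + (1 - \<tau>) * (m * g (row_avg y))"
    by simp
  have "s \<bullet> (Z - rep_rows w) = I + (Proj ** s) \<bullet> (Proj ** Z)"
    using inner_Proj_decomposition[of s "Z - rep_rows w"] by (simp add: I_def m_def Proj_diff)
  moreover have "- ((Proj ** s) \<bullet> (Proj ** Z)) \<le> J"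
    using Cauchy_Schwarz_ineq2[of "Proj ** s" "Proj ** Z"] unfolding J_def by linarith
  ultimately have "I - s \<bullet> (Z - rep_rows w) \<le> J" by linarith
  then have D: "\<tau> * (I - s \<bullet> (Z - rep_rows w)) \<le> \<tau> * J"
    using \<tau> by (intro mult_left_mono) auto
  obtain Q fy' gy' where Q: "Q = (1 - \<tau>) / (2 * L) * ?P" and y': "fy' = avg_fun f ?y'" "gy' = g ?y'"
    by blast
  show ?thesis
    using A B C D unfolding objective_def J_def[symmetric] Q[symmetric] y'[symmetric]
    by (simp add: algebra_simps add_divide_distrib)
qed

section \<open>Lyapunov analysis\<close>

lemma sq_add_le: "(a + b)\<^sup>2 \<le> 2 * a\<^sup>2 + 2 * b\<^sup>2" for a b :: real
  using zero_le_power2[of "a - b"] by (simp add: power2_eq_square algebra_simps)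

lemma sq_add3_le: "(a + b + c)\<^sup>2 \<le> 3 * (a\<^sup>2 + b\<^sup>2 + c\<^sup>2)" for a b c :: real
  using zero_le_power2[of "a - b"] zero_le_power2[of "a - c"] zero_le_power2[of "b - c"]
  by (simp add: power2_eq_square algebra_simps)

text \<open>The recursions for the disagreement \<open>S\<close> of the scaled gradient trackers, \<open>Z\<close> of the proximal
  points, \<open>Y\<close> of the points \<open>y\<close> divided by \<open>\<tau>\<close>, and for the squared scaled gradient change \<open>P\<close>
  contain no parameter of the problem; their coupling constants are so small that the plain sum of
  the squares is a Lyapunov function.  The errors proportional to \<open>\<Delta>\<^sup>2\<close> and \<open>G\<close> are absorbed by the
  negative terms in the first assumption.\<close>

lemma consensus_lyapunov_step:
  fixes S S' Z Z' Y Y' P P' G \<Delta> q E' E :: real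
  assumes main: "E' \<le> E - (1 / 2 - 1 / 800) * \<Delta>\<^sup>2 - 190 * G + 1 / 800 * (Z + Y)\<^sup>2 + S' * (Z + S')"
    and S: "S'\<^sup>2 \<le> 3 / 8192 * (S\<^sup>2 + G + P)"
    and Z: "Z'\<^sup>2 \<le> (Z + S')\<^sup>2 / 8192"
    and Y: "Y'\<^sup>2 \<le> (Z' + Y)\<^sup>2 / 8192"
    and P: "P' \<le> (\<Delta>\<^sup>2 + (Z + Y)\<^sup>2) / 160000"
    and pos: "0 \<le> G" "0 \<le> P" and q: "39 / 40 \<le> q"
  shows "E' + (S'\<^sup>2 + Z'\<^sup>2 + Y'\<^sup>2 + P') \<le> E + q * (S\<^sup>2 + Z\<^sup>2 + Y\<^sup>2 + P)"
proof -
  have "0 \<le> (S' - Z)\<^sup>2" by simp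
  then have "S' * (Z + S') \<le> 3 / 2 * S'\<^sup>2 + 1 / 2 * Z\<^sup>2"
    by (simp add: power2_eq_square algebra_simps)
  moreover have "39 / 40 * (S\<^sup>2 + Z\<^sup>2 + Y\<^sup>2 + P) \<le> q * (S\<^sup>2 + Z\<^sup>2 + Y\<^sup>2 + P)"
    using q pos by (intro mult_right_mono) auto
  ultimately show ?thesis
    using main S Z Y P pos sq_add_le[of Z Y] sq_add_le[of Z S'] sq_add_le[of Z' Y]
      zero_le_power2[of S] zero_le_power2[of Z] zero_le_power2[of Y] zero_le_power2[of \<Delta>]
      zero_le_power2[of S'] zero_le_power2[of Z']
    by argo
qed

text \<open>The step inequality contracts \<open>V + D / (2 * q) + \<Psi>\<close> by \<open>q\<close>, because \<open>1 / q \<le> 1 + \<tau>\<close>.  Only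
  \<open>T - 1\<close> steps lead to \<open>D T\<close>; the missing factor \<open>q\<close> comes from the weight of \<open>D\<close> in this
  potential.  In the first step \<open>D\<close> already carries the smaller weight \<open>1 / 2\<close>, and half of the
  decrease of \<open>V\<close> makes up for it since \<open>1 / 2 * D 1 \<le> V 1\<close>.\<close>

lemma geometric_decay:
  fixes V D \<Psi> :: "nat \<Rightarrow> real" and \<tau> :: real
  defines "q \<equiv> 1 - \<tau> / 2"
  assumes \<tau>: "0 < \<tau>" "\<tau> \<le> 1"
    and step: "\<And>t. 1 \<le> t \<Longrightarrow>
      V (t + 1) + 1 / 2 * (1 + \<tau>) * D (t + 1) + \<Psi> (t + 1) \<le> (1 - \<tau>) * V t + 1 / 2 * D t + q * \<Psi> t"
    and pos: "\<And>t. 0 \<le> V t" "\<And>t. 0 \<le> D t" "\<And>t. 0 \<le> \<Psi> t"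
    and init: "1 / 2 * D 1 \<le> V 1" and T: "1 \<le> T"
  shows "D T \<le> q ^ T * (2 * V 1 + D 1 + 2 * \<Psi> 1)"
proof -
  have q: "1 / 2 \<le> q" "q \<le> 1" using \<tau> by (auto simp: q_def)
  define C where "C = V 1 + 1 / 2 * D 1 + \<Psi> 1"
  have weight: "1 / q \<le> 1 + \<tau>"
  proof -
    have "0 \<le> \<tau> * (1 - \<tau>)" using \<tau> by simp
    then have "1 \<le> (1 + \<tau>) * q" by (simp add: q_def algebra_simps)
    then show ?thesis using q by (simp add: field_simps)
  qed
  have step': "V (t + 1) + 1 / (2 * q) * D (t + 1) + \<Psi> (t + 1)
      \<le> (1 - \<tau>) * V t + 1 / 2 * D t + q * \<Psi> t" if "1 \<le> t" for t
    using step[OF that] mult_right_mono[OF weight pos(2)[of "t + 1"]] by simp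
  have Phi: "V (n + 2) + 1 / (2 * q) * D (n + 2) + \<Psi> (n + 2) \<le> q ^ (n + 1) * C" for n
  proof (induction n)
    case 0
    have "\<tau> * (1 / 2 * D 1) \<le> \<tau> * V 1" using init \<tau> by (intro mult_left_mono) auto
    then have "(1 - \<tau>) * V 1 + 1 / 2 * D 1 + q * \<Psi> 1 \<le> q * C"
      by (simp add: q_def C_def algebra_simps diff_divide_distrib)
    with step'[of 1] show ?case by (simp add: numeral_2_eq_2)
  next
    case (Suc n)
    have "0 \<le> \<tau> * V (n + 2)" using \<tau> pos by simp
    then have "(1 - \<tau>) * V (n + 2) + 1 / 2 * D (n + 2) + q * \<Psi> (n + 2)
        \<le> q * (V (n + 2) + 1 / (2 * q) * D (n + 2) + \<Psi> (n + 2))"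
      using q by (simp add: distrib_left) (simp add: q_def algebra_simps)
    also have "\<dots> \<le> q * (q ^ (n + 1) * C)" using Suc q by (intro mult_left_mono) auto
    finally show ?case using step'[of "n + 2"] by simp
  qed
  show ?thesis
  proof (cases "T = 1")
    case True
    have "1 / 2 * (2 * V 1 + D 1 + 2 * \<Psi> 1) \<le> q * (2 * V 1 + D 1 + 2 * \<Psi> 1)"
      using q pos by (intro mult_right_mono) (simp_all add: add_nonneg_nonneg)
    then show ?thesis using True init pos(3)[of 1] by simp
  next
    case False
    then obtain n where n: "T = n + 2" using T
      by (metis One_nat_def Suc_1 add.commute le_Suc_ex le_neq_implies_less Suc_leI)
    have "1 / (2 * q) * D (n + 2) \<le> q ^ (n + 1) * C"
      using Phi[of n] pos(1)[of "n + 2"] pos(3)[of "n + 2"] by linarith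
    then have "D (n + 2) \<le> 2 * q * (q ^ (n + 1) * C)" using q by (simp add: field_simps)
    also have "\<dots> = q ^ (n + 2) * (2 * V 1 + D 1 + 2 * \<Psi> 1)" by (simp add: C_def algebra_simps)
    finally show ?thesis by (simp add: n)
  qed
qed

text \<open>At the minimizer, minus the average gradient of the \<open>f i\<close> is a subgradient of \<open>g\<close>; the strong
  convexity of \<open>g\<close> at this subgradient gives the quadratic growth of the objective.\<close>

lemma objective_minimizer:
  fixes f :: "'m::finite \<Rightarrow> real^'d \<Rightarrow> real"
  assumes f: "\<And>i. convex_smooth L (f i)" and L: "0 < L" and g: "strongly_convex \<mu> g"
    and min: "is_arg_min (objective f g) (\<lambda>w. True) xs"
  shows "\<exists>u. is_subgradient g xs u"
    and "\<mu> / 2 * (norm (w - xs))\<^sup>2 \<le> objective f g w - objective f g xs"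
proof -
  let ?m = "real CARD('m)"
  define v where "v = row_avg (grad_rows f (rep_rows xs))"
  have lin: "grad_rows f (rep_rows xs) \<bullet> (rep_rows w - rep_rows xs) = ?m * (v \<bullet> (w - xs))" for w
    by (simp add: inner_diff_right inner_rep_rows v_def right_diff_distrib)
  have up: "avg_fun f w \<le> avg_fun f xs + v \<bullet> (w - xs) + L / 2 * (norm (w - xs))\<^sup>2" for w
  proof -
    have "?m * avg_fun f w \<le> ?m * avg_fun f xs + ?m * (v \<bullet> (w - xs)) + L / 2 * (?m * (norm (w - xs))\<^sup>2)"
      using sum_smooth_upper[of L f "rep_rows w" "rep_rows xs", OF f] lin
      by (simp add: avg_fun_sum norm_sq_eq_sum_rows)
    then have "?m * avg_fun f w \<le> ?m * (avg_fun f xs + v \<bullet> (w - xs) + L / 2 * (norm (w - xs))\<^sup>2)"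
      by (simp add: algebra_simps)
    then show ?thesis by (rule mult_left_le_imp_le) simp
  qed
  have low: "avg_fun f xs + v \<bullet> (w - xs) \<le> avg_fun f w"
  proof -
    have "0 \<le> 1 / (2 * L) * (norm (grad_rows f (rep_rows w) - grad_rows f (rep_rows xs :: real^'d^'m)))\<^sup>2"
      using L by simp
    then have "?m * avg_fun f xs + ?m * (v \<bullet> (w - xs)) \<le> ?m * avg_fun f w"
      using sum_bregman_lower[of L f "rep_rows xs" "rep_rows w", OF f L] lin
      by (simp add: avg_fun_sum)
    then have "?m * (avg_fun f xs + v \<bullet> (w - xs)) \<le> ?m * avg_fun f w"
      by (simp add: algebra_simps)
    then show ?thesis by (rule mult_left_le_imp_le) simp
  qed
  have sub: "is_subgradient g xs (- v)"
  proof (rule minimizer_subgradient[where \<phi> = "avg_fun f", OF _ up])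
    show "convex_on UNIV g" using g by (simp add: strongly_convex_def)
    show "avg_fun f xs + g xs \<le> avg_fun f w + g w" for w
      using min by (simp add: is_arg_min_linorder objective_def)
  qed
  then show "\<exists>u. is_subgradient g xs u" by blast
  have "g xs + (- v) \<bullet> (w - xs) + \<mu> / 2 * (norm (w - xs))\<^sup>2 \<le> g w"
    using sub g unfolding strongly_convex_def by blast
  then show "\<mu> / 2 * (norm (w - xs))\<^sup>2 \<le> objective f g w - objective f g xs"
    using low by (simp add: objective_def)
qed

section \<open>Linear convergence\<close>

text \<open>In the scaling of \<open>\<Psi>\<close> all consensus recursions become independent of the condition number, since
  \<open>L * \<tau>\<^sup>2 = \<mu> / 400\<close> and \<open>L * \<gamma> * \<tau> = 1 / 400\<close>.  The change of the gradients from \<open>x\<close> to \<open>x'\<close>, which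
  perturbs the trackers, is split at the average of \<open>y\<close>: the part from there to \<open>x'\<close> is
  controlled by the Bregman gap of the descent estimate, the part from \<open>x\<close> by the length of the
  previous proximal step, as \<open>y\<close> and \<open>x\<close> have averages differing by \<open>\<tau>\<close> times the change of the
  average of \<open>z\<close>, and by the disagreement of \<open>x\<close>.  Bounding the whole change directly by the distance of \<open>y\<close> and \<open>z\<close> would produce a fixed multiple
  of \<open>V + D\<close>, of which the contraction has only the fraction \<open>\<tau>\<close> to spare.\<close>

lemma odapg_lyapunov_step:
  fixes f :: "'m::finite \<Rightarrow> real^'d \<Rightarrow> real" and g :: "real^'d \<Rightarrow> real"
    and x x' y y' z z' s s' :: "real^'d^'m" and w :: "real^'d" and L \<mu> \<gamma> \<tau> :: real
  defines "V \<equiv> \<lambda>y :: real^'d^'m. real CARD('m) / \<mu> * (objective f g (row_avg y) - objective f g w)"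
    and "\<Psi> \<equiv> \<lambda>x y z s :: real^'d^'m. (\<gamma> * norm (Proj ** s))\<^sup>2 + (norm (Proj ** z))\<^sup>2
      + (norm (Proj ** y) / \<tau>)\<^sup>2 + (\<gamma> * norm (grad_rows f (rep_rows (row_avg y)) - grad_rows f x))\<^sup>2"
  assumes W: "weight_matrix E W" and K: "K = nat \<lceil>15 / sqrt (1 - lambda2 W)\<rceil>"
    and f: "\<And>i. convex_smooth L (f i)" and g: "strongly_convex \<mu> g" and sub: "is_subgradient g a u"
    and \<mu>: "0 < \<mu>" and L: "0 < L" and \<gamma>: "0 < \<gamma>" and \<gamma>2: "400 * L * \<mu> * \<gamma>\<^sup>2 = 1"
    and \<tau>: "\<tau> = \<mu> * \<gamma>" "\<tau> \<le> 1 / 20"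
    and s_avg: "row_avg s = row_avg (grad_rows f x)"
    and x': "x' = \<tau> *\<^sub>R z + (1 - \<tau>) *\<^sub>R y"
    and s': "s' = FastMix W (s + grad_rows f x' - grad_rows f x) K"
    and z': "z' = FastMix W (prox_rows \<gamma> g (z - \<gamma> *\<^sub>R s')) K"
    and y': "y' = FastMix W (\<tau> *\<^sub>R z' + (1 - \<tau>) *\<^sub>R y) K"
  shows "V y' + 1 / 2 * (1 + \<tau>) * (norm (z' - rep_rows w))\<^sup>2 + \<Psi> x' y' z' s'
    \<le> (1 - \<tau>) * V y + 1 / 2 * (norm (z - rep_rows w))\<^sup>2 + (1 - \<tau> / 2) * \<Psi> x y z s"
proof -
  have conv: "convex_on UNIV g" using g by (simp add: strongly_convex_def)
  have \<tau>0: "0 < \<tau>" and \<tau>1: "\<tau> \<le> 1" using \<mu> \<gamma> \<tau> by auto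
  have L\<tau>2: "L * \<tau>\<^sup>2 = \<mu> / 400"
    using \<gamma>2 by (simp add: \<tau>(1) power2_eq_square field_simps)
  have L\<gamma>\<tau>: "L * \<gamma> * \<tau> = 1 / 400"
    using \<gamma>2 by (simp add: \<tau>(1) power2_eq_square field_simps)
  \<comment> \<open>\<open>h\<close> are the proximal points before mixing, \<open>p\<close> and \<open>r\<close> the two parts of the gradient change\<close>
  define h where "h = prox_rows \<gamma> g (z - \<gamma> *\<^sub>R s')"
  define S where "S = \<gamma> * norm (Proj ** s)"
  define S' where "S' = \<gamma> * norm (Proj ** s')"
  define Z where "Z = norm (Proj ** z)"
  define Z' where "Z' = norm (Proj ** z')"
  define Y where "Y = norm (Proj ** y) / \<tau>"
  define Y' where "Y' = norm (Proj ** y') / \<tau>"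
  define p where "p = \<gamma> * norm (grad_rows f (rep_rows (row_avg y)) - grad_rows f x)"
  define p' where "p' = \<gamma> * norm (grad_rows f (rep_rows (row_avg y')) - grad_rows f x')"
  define r where "r = \<gamma> * norm (grad_rows f (rep_rows (row_avg y)) - grad_rows f x')"
  define \<Delta> where "\<Delta> = norm (h - z)"
  have nonneg: "0 \<le> S" "0 \<le> S'" "0 \<le> Z" "0 \<le> Z'" "0 \<le> Y" "0 \<le> p" "0 \<le> r"
    using \<gamma> \<tau>0 by (auto simp: S_def S'_def Z_def Z'_def Y_def p_def r_def)
  have Proj_y: "norm (Proj ** y) = \<tau> * Y" using \<tau>0 by (simp add: Y_def)
  have avg_s': "row_avg s' = row_avg (grad_rows f x')"
    unfolding s' row_avg_FastMix[OF W] by (simp add: s_avg)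
  have avg_z': "row_avg z' = row_avg h" unfolding z' h_def row_avg_FastMix[OF W] ..
  have avg_y': "row_avg y' = \<tau> *\<^sub>R row_avg h + (1 - \<tau>) *\<^sub>R row_avg y"
    unfolding y' row_avg_FastMix[OF W] by (simp add: avg_z')

  have Proj_x': "norm (Proj ** x') \<le> \<tau> * (Z + Y)"
  proof -
    have "norm (Proj ** x') \<le> norm (\<tau> *\<^sub>R (Proj ** z)) + norm ((1 - \<tau>) *\<^sub>R (Proj ** y))"
      unfolding x' Proj_add Proj_scaleR by (rule norm_triangle_ineq)
    also have "\<dots> = \<tau> * Z + (1 - \<tau>) * (\<tau> * Y)" using \<tau>0 \<tau>1 by (simp add: Z_def Proj_y)
    also have "\<dots> \<le> \<tau> * Z + 1 * (\<tau> * Y)"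
      using \<tau>0 nonneg by (intro add_left_mono mult_right_mono) auto
    finally show ?thesis by (simp add: algebra_simps)
  qed
  then have Proj_x'2: "(norm (Proj ** x'))\<^sup>2 \<le> \<tau>\<^sup>2 * (Z + Y)\<^sup>2"
    by (metis norm_ge_zero power_mono power_mult_distrib)

  have Proj_h: "norm (Proj ** h) \<le> Z + S'"
  proof -
    have "norm (Proj ** h) \<le> norm (Proj ** (z - \<gamma> *\<^sub>R s'))"
      unfolding h_def by (rule norm_Proj_prox_rows_le[OF conv \<gamma> sub])
    also have "\<dots> \<le> norm (Proj ** z) + norm (\<gamma> *\<^sub>R (Proj ** s'))"
      unfolding Proj_diff Proj_scaleR by (rule norm_triangle_ineq4)
    finally show ?thesis using \<gamma> by (simp add: Z_def S'_def)
  qed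

  have Z_rec: "Z'\<^sup>2 \<le> (Z + S')\<^sup>2 / 8192"
  proof -
    have "Z'\<^sup>2 \<le> (norm (Proj ** h))\<^sup>2 / 8192"
      unfolding Z'_def z' h_def by (rule norm_Proj_FastMix_le[OF W K])
    also have "\<dots> \<le> (Z + S')\<^sup>2 / 8192"
      using Proj_h by (intro divide_right_mono power_mono) auto
    finally show ?thesis .
  qed

  have Y_rec: "Y'\<^sup>2 \<le> (Z' + Y)\<^sup>2 / 8192"
  proof -
    have "norm (Proj ** (\<tau> *\<^sub>R z' + (1 - \<tau>) *\<^sub>R y)) \<le> norm (\<tau> *\<^sub>R (Proj ** z')) + norm ((1 - \<tau>) *\<^sub>R (Proj ** y))"
      unfolding Proj_add Proj_scaleR by (rule norm_triangle_ineq)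
    also have "\<dots> = \<tau> * Z' + (1 - \<tau>) * (\<tau> * Y)" using \<tau>0 \<tau>1 by (simp add: Z'_def Proj_y)
    also have "\<dots> \<le> \<tau> * Z' + 1 * (\<tau> * Y)"
      using \<tau>0 nonneg by (intro add_left_mono mult_right_mono) auto
    finally have "norm (Proj ** (\<tau> *\<^sub>R z' + (1 - \<tau>) *\<^sub>R y)) \<le> \<tau> * (Z' + Y)" by (simp add: algebra_simps)
    then have "(norm (Proj ** (\<tau> *\<^sub>R z' + (1 - \<tau>) *\<^sub>R y)))\<^sup>2 \<le> (\<tau> * (Z' + Y))\<^sup>2"
      by (intro power_mono) auto
    then have "(norm (Proj ** y'))\<^sup>2 \<le> (\<tau> * (Z' + Y))\<^sup>2 / 8192"
      using norm_Proj_FastMix_le[OF W K, of "\<tau> *\<^sub>R z' + (1 - \<tau>) *\<^sub>R y"] unfolding y' by linarith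
    then have "(norm (Proj ** y'))\<^sup>2 \<le> (Z' + Y)\<^sup>2 / 8192 * \<tau>\<^sup>2"
      by (simp add: power_mult_distrib mult.commute)
    then show ?thesis using \<tau>0 by (simp add: Y'_def power_divide pos_divide_le_eq)
  qed

  have S_rec: "S'\<^sup>2 \<le> 3 / 8192 * (S\<^sup>2 + r\<^sup>2 + p\<^sup>2)"
  proof -
    let ?a = "grad_rows f (rep_rows (row_avg y)) - grad_rows f x'"
      and ?b = "grad_rows f (rep_rows (row_avg y)) - grad_rows f x"
    have "s + grad_rows f x' - grad_rows f x = s - ?a + ?b" by simp
    then have "norm (Proj ** (s + grad_rows f x' - grad_rows f x))
        = norm (Proj ** s - Proj ** ?a + Proj ** ?b)"
      by (simp only: Proj_add Proj_diff)
    also have "\<dots> \<le> norm (Proj ** s) + norm (Proj ** ?a) + norm (Proj ** ?b)"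
      using norm_triangle_ineq[of "Proj ** s - Proj ** ?a" "Proj ** ?b"]
        norm_triangle_ineq4[of "Proj ** s" "Proj ** ?a"] by linarith
    also have "\<dots> \<le> norm (Proj ** s) + norm ?a + norm ?b"
      by (intro add_mono norm_Proj_le order_refl)
    finally have "\<gamma> * norm (Proj ** (s + grad_rows f x' - grad_rows f x))
        \<le> \<gamma> * (norm (Proj ** s) + norm ?a + norm ?b)"
      using \<gamma> by (intro mult_left_mono) auto
    also have "\<dots> = S + r + p" by (simp add: S_def r_def p_def distrib_left)
    finally have "(\<gamma> * norm (Proj ** (s + grad_rows f x' - grad_rows f x)))\<^sup>2 \<le> (S + r + p)\<^sup>2"
      using \<gamma> by (intro power_mono) auto
    also have "\<dots> \<le> 3 * (S\<^sup>2 + r\<^sup>2 + p\<^sup>2)" by (rule sq_add3_le)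
    finally have "\<gamma>\<^sup>2 * (norm (Proj ** (s + grad_rows f x' - grad_rows f x)))\<^sup>2 \<le> 3 * (S\<^sup>2 + r\<^sup>2 + p\<^sup>2)"
      by (simp add: power_mult_distrib)
    moreover have "S'\<^sup>2 \<le> \<gamma>\<^sup>2 * ((norm (Proj ** (s + grad_rows f x' - grad_rows f x)))\<^sup>2 / 8192)"
      unfolding S'_def power_mult_distrib s'
      by (intro mult_left_mono norm_Proj_FastMix_le[OF W K]) simp
    ultimately show ?thesis by simp
  qed

  have p_rec: "p'\<^sup>2 \<le> (\<Delta>\<^sup>2 + (Z + Y)\<^sup>2) / 160000"
  proof -
    have "row_avg x' - row_avg y' = \<tau> *\<^sub>R (row_avg z - row_avg h)"
      unfolding x' avg_y' by (simp add: algebra_simps)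
    then have "norm (row_avg x' - row_avg y') = \<tau> * norm (row_avg (h - z))"
      using \<tau>0 by (simp add: norm_minus_commute)
    then have "(norm (x' - rep_rows (row_avg y')))\<^sup>2
        = \<tau>\<^sup>2 * (real CARD('m) * (norm (row_avg (h - z)))\<^sup>2) + (norm (Proj ** x'))\<^sup>2"
      unfolding norm_Proj_decomposition by (simp add: power_mult_distrib)
    also have "\<dots> \<le> \<tau>\<^sup>2 * \<Delta>\<^sup>2 + \<tau>\<^sup>2 * (Z + Y)\<^sup>2"
      unfolding \<Delta>_def by (intro add_mono mult_left_mono norm_row_avg_le Proj_x'2) simp
    finally have dist: "(norm (x' - rep_rows (row_avg y')))\<^sup>2 \<le> \<tau>\<^sup>2 * (\<Delta>\<^sup>2 + (Z + Y)\<^sup>2)"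
      by (simp add: distrib_left)
    have "p' \<le> \<gamma> * (L * norm (rep_rows (row_avg y') - x'))"
      unfolding p'_def using \<gamma> by (intro mult_left_mono grad_rows_lipschitz[OF f L]) auto
    then have "p'\<^sup>2 \<le> (\<gamma> * (L * norm (rep_rows (row_avg y') - x')))\<^sup>2"
      using \<gamma> by (intro power_mono) (auto simp: p'_def)
    also have "\<dots> = (L * \<gamma>)\<^sup>2 * (norm (x' - rep_rows (row_avg y')))\<^sup>2"
      by (simp add: power_mult_distrib norm_minus_commute)
    also have "\<dots> \<le> (L * \<gamma>)\<^sup>2 * (\<tau>\<^sup>2 * (\<Delta>\<^sup>2 + (Z + Y)\<^sup>2))"
      by (intro mult_left_mono dist) simp
    also have "\<dots> = (L * \<gamma> * \<tau>)\<^sup>2 * (\<Delta>\<^sup>2 + (Z + Y)\<^sup>2)" by (simp add: power_mult_distrib)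
    also have "\<dots> = (\<Delta>\<^sup>2 + (Z + Y)\<^sup>2) / 160000" unfolding L\<gamma>\<tau> by (simp add: power2_eq_square)
    finally show ?thesis .
  qed

  \<comment> \<open>\<open>1 / 800\<close> is \<open>L * \<tau>\<^sup>2 / (2 * \<mu>)\<close>; the Bregman gap, divided by \<open>\<mu>\<close>, contributes
     \<open>200 * (1 - \<tau>) \<ge> 190\<close> times \<open>r\<^sup>2\<close>\<close>
  have main: "V y' + 1 / 2 * (1 + \<tau>) * (norm (z' - rep_rows w))\<^sup>2
    \<le> ((1 - \<tau>) * V y + 1 / 2 * (norm (z - rep_rows w))\<^sup>2)
      - (1 / 2 - 1 / 800) * \<Delta>\<^sup>2 - 190 * r\<^sup>2 + 1 / 800 * (Z + Y)\<^sup>2 + S' * (Z + S')"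
  proof -
    let ?m = "real CARD('m)"
    let ?d = "\<lambda>v. ?m * (objective f g v - objective f g w)"
    let ?P = "(norm (grad_rows f (rep_rows (row_avg y)) - grad_rows f x'))\<^sup>2"
    define Q where "Q = (1 - \<tau>) / (2 * L) * ?P"
    have "?d (row_avg y') + \<mu> / 2 * (1 + \<tau>) * (norm (h - rep_rows w))\<^sup>2
        \<le> (1 - \<tau>) * ?d (row_avg y) + \<mu> / 2 * (norm (z - rep_rows w))\<^sup>2
          - (\<mu> / 2 - L * \<tau>\<^sup>2 / 2) * \<Delta>\<^sup>2
          + L / 2 * (norm (Proj ** x'))\<^sup>2 + \<tau> * (norm (Proj ** s') * norm (Proj ** h))
          - Q"
      unfolding avg_y' \<Delta>_def Q_def
      by (rule odapg_step_inequality[OF f L g sub \<gamma> \<tau>(1) _ \<tau>1 x' avg_s' h_def]) (use \<tau>0 in simp)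
    moreover have "L / 2 * (norm (Proj ** x'))\<^sup>2 \<le> \<mu> * (1 / 800 * (Z + Y)\<^sup>2)"
    proof -
      have "L / 2 * (norm (Proj ** x'))\<^sup>2 \<le> L / 2 * (\<tau>\<^sup>2 * (Z + Y)\<^sup>2)"
        using L by (intro mult_left_mono Proj_x'2) auto
      also have "\<dots> = L * \<tau>\<^sup>2 * (1 / 2 * (Z + Y)\<^sup>2)" by simp
      also have "\<dots> = \<mu> * (1 / 800 * (Z + Y)\<^sup>2)" unfolding L\<tau>2 by simp
      finally show ?thesis .
    qed
    moreover have "\<tau> * (norm (Proj ** s') * norm (Proj ** h)) \<le> \<mu> * (S' * (Z + S'))"
    proof -
      have "\<tau> * (norm (Proj ** s') * norm (Proj ** h)) = \<mu> * (S' * norm (Proj ** h))"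
        by (simp add: \<tau>(1) S'_def)
      also have "\<dots> \<le> \<mu> * (S' * (Z + S'))"
        using \<mu> nonneg by (intro mult_left_mono Proj_h) auto
      finally show ?thesis .
    qed
    moreover have "\<mu> * (190 * r\<^sup>2) \<le> Q"
    proof -
      have "1 / (2 * L) = 400 * L * \<mu> * \<gamma>\<^sup>2 / (2 * L)" by (simp only: \<gamma>2)
      also have "\<dots> = 200 * \<mu> * \<gamma>\<^sup>2" using L by simp
      finally have inv: "1 / (2 * L) = 200 * \<mu> * \<gamma>\<^sup>2" .
      have "Q = (1 - \<tau>) * (1 / (2 * L) * ?P)" by (simp add: Q_def)
      also have "\<dots> = (1 - \<tau>) * (200 * \<mu> * r\<^sup>2)"
        unfolding inv r_def by (simp add: power_mult_distrib)
      finally have "Q = (1 - \<tau>) * (200 * \<mu> * r\<^sup>2)" .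
      moreover have "19 / 20 * (200 * \<mu> * r\<^sup>2) \<le> (1 - \<tau>) * (200 * \<mu> * r\<^sup>2)"
        using \<tau> \<mu> by (intro mult_right_mono) auto
      ultimately show ?thesis by simp
    qed
    moreover have "(norm (z' - rep_rows w))\<^sup>2 \<le> (norm (h - rep_rows w))\<^sup>2"
    proof -
      have "(norm (Proj ** z'))\<^sup>2 \<le> (norm (Proj ** h))\<^sup>2 / 8192"
        unfolding z' h_def by (rule norm_Proj_FastMix_le[OF W K])
      also have "\<dots> \<le> (norm (Proj ** h))\<^sup>2" by simp
      finally show ?thesis unfolding norm_Proj_decomposition avg_z' by simp
    qed
    then have "\<mu> / 2 * (1 + \<tau>) * (norm (z' - rep_rows w))\<^sup>2 \<le> \<mu> / 2 * (1 + \<tau>) * (norm (h - rep_rows w))\<^sup>2"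
      using \<mu> \<tau>0 by (intro mult_left_mono) auto
    moreover have "?d (row_avg y') = \<mu> * V y'" "?d (row_avg y) = \<mu> * V y" using \<mu> by (simp_all add: V_def)
    ultimately have "\<mu> * (V y' + 1 / 2 * (1 + \<tau>) * (norm (z' - rep_rows w))\<^sup>2)
        \<le> \<mu> * (((1 - \<tau>) * V y + 1 / 2 * (norm (z - rep_rows w))\<^sup>2)
          - (1 / 2 - 1 / 800) * \<Delta>\<^sup>2 - 190 * r\<^sup>2 + 1 / 800 * (Z + Y)\<^sup>2 + S' * (Z + S'))"
      unfolding L\<tau>2 by (simp add: algebra_simps add_divide_distrib)
    then show ?thesis using \<mu> by (rule mult_left_le_imp_le)
  qed
  have "V y' + 1 / 2 * (1 + \<tau>) * (norm (z' - rep_rows w))\<^sup>2 + (S'\<^sup>2 + Z'\<^sup>2 + Y'\<^sup>2 + p'\<^sup>2)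
      \<le> ((1 - \<tau>) * V y + 1 / 2 * (norm (z - rep_rows w))\<^sup>2) + (1 - \<tau> / 2) * (S\<^sup>2 + Z\<^sup>2 + Y\<^sup>2 + p\<^sup>2)"
    by (rule consensus_lyapunov_step[OF main S_rec Z_rec Y_rec p_rec]) (use \<tau>(2) in auto)
  then show ?thesis
    unfolding \<Psi>_def S_def S'_def Z_def Z'_def Y_def Y'_def p_def p'_def by simp
qed

theorem theorem1:
  fixes f :: "'m::finite \<Rightarrow> real^'d \<Rightarrow> real"
    and g :: "real^'d \<Rightarrow> real"
    and E :: "('m \<times> 'm) set"
    and W :: "real^'m^'m"
    and L \<mu> \<gamma> \<tau> c\<^sub>1 c\<^sub>2 c\<^sub>3 :: real
    and K T :: nat
    and x\<^sub>1 xstar :: "real^'d"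
    and x y z s :: "nat \<Rightarrow> real^'d^'m"
  assumes "connected_network E"
    and "weight_matrix E W"
    and "\<And>i. convex_smooth L (f i)"
    and "strongly_convex \<mu> g"
    and "0 < \<mu>" and "\<mu> \<le> L"
    and "\<gamma> = 1 / (20 * sqrt (L * \<mu>))"
    and "\<tau> = \<mu> * \<gamma>"
    and "K = nat \<lceil>15 / sqrt (1 - lambda2 W)\<rceil>"
    and "ODAPG W f g (\<lambda>t. \<gamma>) (\<lambda>t. \<tau>) K x\<^sub>1 x y z s"
    and "is_arg_min (objective f g) (\<lambda>w. True) xstar"
    and "c\<^sub>1 = 64" and "c\<^sub>2 = 9 * \<tau>\<^sup>2 / 32" and "c\<^sub>3 = 5 * \<tau>\<^sup>2 / 14"
    and "1 \<le> T"
  shows "(norm (z T - rep_rows xstar))\<^sup>2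
    \<le> (1 - 1 / 40 * sqrt (\<mu> / L)) ^ T *
        (2 * real CARD('m) / \<mu> * (objective f g (row_avg (y 1)) - objective f g xstar)
         + (norm (z 1 - rep_rows xstar))\<^sup>2
         + 6 * 20\<^sup>2 * L / \<mu> *
             ((norm (Proj ** x 1))\<^sup>2 + c\<^sub>1 * (norm (Proj ** y 1))\<^sup>2
              + c\<^sub>2 * (norm (Proj ** z 1))\<^sup>2 + c\<^sub>3 * \<gamma>\<^sup>2 * (norm (Proj ** s 1))\<^sup>2))"
proof -
  note W = assms(2) and f = assms(3) and g = assms(4) and \<mu> = assms(5) and K = assms(9)
    and min = assms(11) and T = assms(15)
  have L: "0 < L" using assms(5,6) by simp
  have \<gamma>: "0 < \<gamma>" using \<mu> L by (simp add: assms(7))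
  have \<gamma>2: "400 * L * \<mu> * \<gamma>\<^sup>2 = 1"
    using \<mu> L by (simp add: assms(7) power_divide power_mult_distrib)
  have "\<mu> * \<gamma> = 1 / 20 * sqrt (\<mu> / L)"
  proof -
    have "sqrt (\<mu> / L) = \<mu> / sqrt (L * \<mu>)"
      using \<mu> L by (simp add: real_sqrt_divide real_sqrt_mult field_simps)
    then show ?thesis by (simp add: assms(7))
  qed
  then have \<tau>_eq: "\<tau> = 1 / 20 * sqrt (\<mu> / L)" by (simp add: assms(8))
  have "sqrt (\<mu> / L) \<le> 1" using assms(5,6) L by simp
  then have \<tau>20: "\<tau> \<le> 1 / 20" unfolding \<tau>_eq by simp
  have \<tau>0: "0 < \<tau>" using \<mu> \<gamma> by (simp add: assms(8))
  have init: "x 1 = rep_rows x\<^sub>1" "y 1 = rep_rows x\<^sub>1" "z 1 = rep_rows x\<^sub>1" "s 1 = grad_rows f (x 1)"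
    and rec: "\<And>t. 1 \<le> t \<Longrightarrow> x (t + 1) = \<tau> *\<^sub>R z t + (1 - \<tau>) *\<^sub>R y t"
      "\<And>t. 1 \<le> t \<Longrightarrow> s (t + 1) = FastMix W (s t + grad_rows f (x (t + 1)) - grad_rows f (x t)) K"
      "\<And>t. 1 \<le> t \<Longrightarrow> z (t + 1) = FastMix W (prox_rows \<gamma> g (z t - \<gamma> *\<^sub>R s (t + 1))) K"
      "\<And>t. 1 \<le> t \<Longrightarrow> y (t + 1) = FastMix W (\<tau> *\<^sub>R z (t + 1) + (1 - \<tau>) *\<^sub>R y t) K"
    using assms(10) unfolding ODAPG_def by blast+
  obtain u where sub: "is_subgradient g xstar u"
    using objective_minimizer(1)[OF f L g min] by blast
  have tracking: "row_avg (s t) = row_avg (grad_rows f (x t))" if "1 \<le> t" for t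
    using that
  proof (induction t rule: dec_induct)
    case (step n)
    then show ?case using rec(2)[of n] by (simp add: row_avg_FastMix[OF W])
  qed (use init in simp)
  define V where "V t = real CARD('m) / \<mu> * (objective f g (row_avg (y t)) - objective f g xstar)" for t
  define D where "D t = (norm (z t - rep_rows xstar))\<^sup>2" for t
  define \<Psi> where "\<Psi> t = (\<gamma> * norm (Proj ** s t))\<^sup>2 + (norm (Proj ** z t))\<^sup>2
      + (norm (Proj ** y t) / \<tau>)\<^sup>2
      + (\<gamma> * norm (grad_rows f (rep_rows (row_avg (y t))) - grad_rows f (x t)))\<^sup>2" for t
  have decay: "D T \<le> (1 - \<tau> / 2) ^ T * (2 * V 1 + D 1 + 2 * \<Psi> 1)"
  proof (rule geometric_decay[OF \<tau>0 _ _ _ _ _ _ T])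
    fix t :: nat assume t: "1 \<le> t"
    show "V (t + 1) + 1 / 2 * (1 + \<tau>) * D (t + 1) + \<Psi> (t + 1)
        \<le> (1 - \<tau>) * V t + 1 / 2 * D t + (1 - \<tau> / 2) * \<Psi> t"
      unfolding V_def D_def \<Psi>_def
      by (rule odapg_lyapunov_step[OF W K f g sub \<mu> L \<gamma> \<gamma>2 assms(8) \<tau>20 tracking[OF t] rec[OF t]])
  next
    show "0 \<le> V t" for t
      using min \<mu> by (simp add: V_def is_arg_min_linorder)
    show "1 / 2 * D 1 \<le> V 1"
    proof -
      have "real CARD('m) * (\<mu> / 2 * (norm (x\<^sub>1 - xstar))\<^sup>2)
          \<le> real CARD('m) * (objective f g x\<^sub>1 - objective f g xstar)"
        by (intro mult_left_mono objective_minimizer(2)[OF f L g min]) simp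
      moreover have "D 1 = real CARD('m) * (norm (x\<^sub>1 - xstar))\<^sup>2"
        unfolding D_def init(3) norm_sq_eq_sum_rows by simp
      ultimately show ?thesis unfolding V_def init(2) row_avg_rep_rows
        using \<mu> by (simp add: field_simps)
    qed
  qed (use \<tau>20 in \<open>auto simp: D_def \<Psi>_def\<close>)
  have "\<Psi> 1 = \<gamma>\<^sup>2 * (norm (Proj ** s 1))\<^sup>2"
    unfolding \<Psi>_def init(1,2,3) by (simp add: power_mult_distrib)
  \<comment> \<open>All rows agree at the start, so that only the tracker term survives on the right; its
     coefficient \<open>15 / 7\<close> exceeds the required \<open>2\<close>.\<close>
  moreover have "6 * 20\<^sup>2 * L / \<mu> * (c\<^sub>3 * \<gamma>\<^sup>2 * (norm (Proj ** s 1))\<^sup>2)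
      = 15 / 7 * (\<gamma>\<^sup>2 * (norm (Proj ** s 1))\<^sup>2)"
  proof -
    have "6 * 20\<^sup>2 * L / \<mu> * c\<^sub>3 = 15 / 7 * (400 * L * \<mu> * \<gamma>\<^sup>2)"
      using \<mu> by (simp add: assms(8,14) power2_eq_square)
    then have "6 * 20\<^sup>2 * L / \<mu> * c\<^sub>3 = 15 / 7" by (simp add: \<gamma>2)
    then show ?thesis by (metis mult.assoc)
  qed
  moreover have "0 \<le> \<gamma>\<^sup>2 * (norm (Proj ** s 1))\<^sup>2" by simp
  moreover have "(norm (Proj ** x 1))\<^sup>2 + c\<^sub>1 * (norm (Proj ** y 1))\<^sup>2
      + c\<^sub>2 * (norm (Proj ** z 1))\<^sup>2 + c\<^sub>3 * \<gamma>\<^sup>2 * (norm (Proj ** s 1))\<^sup>2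
      = c\<^sub>3 * \<gamma>\<^sup>2 * (norm (Proj ** s 1))\<^sup>2"
    unfolding init(1,2,3) by simp
  moreover have "2 * V 1 = 2 * real CARD('m) / \<mu> * (objective f g (row_avg (y 1)) - objective f g xstar)"
    by (simp add: V_def)
  moreover have "D 1 = (norm (z 1 - rep_rows xstar))\<^sup>2" by (simp add: D_def)
  ultimately have init_bound: "2 * V 1 + D 1 + 2 * \<Psi> 1 \<le>
      2 * real CARD('m) / \<mu> * (objective f g (row_avg (y 1)) - objective f g xstar)
         + (norm (z 1 - rep_rows xstar))\<^sup>2
         + 6 * 20\<^sup>2 * L / \<mu> *
             ((norm (Proj ** x 1))\<^sup>2 + c\<^sub>1 * (norm (Proj ** y 1))\<^sup>2
              + c\<^sub>2 * (norm (Proj ** z 1))\<^sup>2 + c\<^sub>3 * \<gamma>\<^sup>2 * (norm (Proj ** s 1))\<^sup>2)"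
    by (simp only:)
  have q: "1 - \<tau> / 2 = 1 - 1 / 40 * sqrt (\<mu> / L)" by (simp add: \<tau>_eq)
  have "0 \<le> (1 - \<tau> / 2) ^ T" using \<tau>20 by simp
  from order_trans[OF decay mult_left_mono[OF init_bound this]] show ?thesis
    unfolding D_def q .
qed

end
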